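(* Suppose the Heun equation $(\mathfrak H)$ has four singular points and is nontrivial ($\alpha\beta\neq0$ or $q\neq0$). Then its local solution $\mathit{Hl}(d,q;\alpha,\beta,\gamma,\delta;t)$ can be reduced to a hypergeometric function ${}_2F_1(a,b;c;z)$ by a formula of the type $\mathit{Hl}(t)={}_2F_1(R(t))$, with $R$ a rational function, only if its parameters $d,q;\alpha,\beta$ satisfy $q=\alpha\beta p$, with $(d,p)$ equal to one of the following $23$ pairs (in each pair the two signs $\pm$ are taken equal). If a reduction of this type exists, $R(t)$ will be a polynomial of the stated degree. (1a) [$\deg R=2$ or $4$] $(-1,0)$, $(\frac12,\frac12)$, $(2,1)$. (1b) [$\deg R=3$] $(-3,0)$, $(-\frac13,0)$, $(\frac14,\frac14)$, $(\frac34,\frac34)$, $(\frac43,1)$, $(4,1)$. (2a) [$\deg R=3$ or $6$] $(\frac12\pm\mathrm i\frac{\sqrt3}2,\ \frac12\pm\mathrm i\frac{\sqrt3}6)$. (2b) [$\deg R=4$] $(\frac12\pm\mathrm i\frac{5\sqrt2}4,\ \frac12\pm\mathrm i\frac{\sqrt2}4)$, $(\frac4{27}\pm\mathrm i\frac{10\sqrt2}{27},\ \frac7{27}\pm\mathrm i\frac{4\sqrt2}{27})$, $(\frac{23}{27}\pm\mathrm i\frac{10\sqrt2}{27},\ \frac{20}{27}\pm\mathrm i\frac{4\sqrt2}{27})$. (2c) [$\deg R=5$] $(\frac12\pm\mathrm i\frac{11\sqrt{15}}{90},\ \frac12\pm\mathrm i\frac{\sqrt{15}}{18})$, $(\frac{135}{128}\pm\mathrm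 i\frac{33\sqrt{15}}{128},\ \frac{95}{128}\pm\mathrm i\frac{9\sqrt{15}}{128})$, $(-\frac7{128}\pm\mathrm i\frac{33\sqrt{15}}{128},\ \frac{33}{128}\pm\mathrm i\frac{9\sqrt{15}}{128})$.
   Context: The hypergeometric equation $(\mathfrak h)$ with parameters $a,b,c\in\mathbb C$ is $$\frac{d^2y}{dz^2}+\left(\frac cz+\frac{a+b-c+1}{z-1}\right)\frac{dy}{dz}+\frac{ab}{z(z-1)}\,y=0 .$$ For $c$ not a nonpositive integer, ${}_2F_1(a,b;c;z)$ is its solution analytic at $z=0$ with value $1$ there. The Heun equation $(\mathfrak H)$ with parameters $d\in\mathbb C\setminus\{0,1\}$, $q,\alpha,\beta,\gamma,\delta,\epsilon\in\mathbb C$ subject to $\alpha+\beta-\gamma-\delta-\epsilon+1=0$ is $$\frac{d^2u}{dt^2}+\left(\frac\gamma t+\frac\delta{t-1}+\frac\epsilon{t-d}\right)\frac{du}{dt}+\frac{\alpha\beta t-q}{t(t-1)(t-d)}\,u=0 .$$ For $\gamma$ not a nonpositive integer, the local Heun function $\mathit{Hl}(d,q;\alpha,\beta,\gamma,\delta;t)$ is its solution analytic at $t=0$ with value $1$ there. The equation "has four singular points" if each of $0,1,d,\infty$ is genuinely a singular point, i.e. none of the following holds: $\gamma=0$ and $q=0$; $\delta=0$ and $q=\alpha\beta$; $\epsilon=0$ and $q=\alpha\beta d$; $\alpha\beta=0$, $\alpha+\beta=1$ and $q=0$. A reduction of $\mathit{Hl}$ to ${}_2F_1$ by a formula $\mathit{Hl}(t)={}_2F_1(R(t))$,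 with $R$ a nonconstant rational function, means one induced by a reduction of the equations: substituting $z=R(t)$ in $(\mathfrak h)$ (for some $a,b,c$), without change of the dependent variable, yields exactly the Heun equation, and $R(0)=0$, so that near $t=0$ the local solution $\mathit{Hl}(d,q;\alpha,\beta,\gamma,\delta;t)$ equals ${}_2F_1(a,b;c;R(t))$. *)

theory Defs
  imports "HOL-Complex_Analysis.Complex_Analysis" "HOL-Library.Nonpos_Ints"
begin

text \<open>A pair \<open>(P, Q)\<close> of coefficient functions stands for the equation
  \<open>y'' + P y' + Q y = 0\<close>.\<close>

type_synonym ode2 = "(complex \<Rightarrow> complex) \<times> (complex \<Rightarrow> complex)"

definition solves_at :: "ode2 \<Rightarrow> (complex \<Rightarrow> complex) \<Rightarrow> complex \<Rightarrow> bool" where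
  "solves_at E y z \<longleftrightarrow> deriv (deriv y) z + fst E z * deriv y z + snd E z * y z = 0"

text \<open>The coefficients are rational functions, so two equations are the same as soon as their
  coefficients agree at all but finitely many points. In particular the values that HOL's
  \<open>x / 0 = 0\<close> assigns at poles play no role.\<close>

definition same_ode :: "ode2 \<Rightarrow> ode2 \<Rightarrow> bool" where
  "same_ode E F \<longleftrightarrow> (\<forall>\<^sub>F t in cofinite. fst E t = fst F t \<and> snd E t = snd F t)"

definition hypergeometric_ode :: "complex \<Rightarrow> complex \<Rightarrow> complex \<Rightarrow> ode2" where
  "hypergeometric_ode a b c =
     (\<lambda>z. c / z + (a + b - c + 1) / (z - 1),
      \<lambda>z. a * b / (z * (z - 1)))"

definition heun_ode ::
  "complex \<Rightarrow> complex \<Rightarrow> complex \<Rightarrow> complex \<Rightarrow> complex \<Rightarrow> complex \<Rightarrow> complex \<Rightarrow> ode2" where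
  "heun_ode d q \<alpha> \<beta> \<gamma> \<delta> \<epsilon> =
     (\<lambda>t. \<gamma> / t + \<delta> / (t - 1) + \<epsilon> / (t - d),
      \<lambda>t. (\<alpha> * \<beta> * t - q) / (t * (t - 1) * (t - d)))"

text \<open>Substituting \<open>z = R(t)\<close> means \<open>d/dz = (1/R'(t)) d/dt\<close> and \<open>u(t) = y(R(t))\<close>. Multiplying
  the result by \<open>R'(t)\<^sup>2\<close> makes it monic again:
  \<open>u'' + (R' P(R) - R''/R') u' + R'\<^sup>2 Q(R) u = 0\<close>.\<close>

definition pullback_ode :: "(complex \<Rightarrow> complex) \<Rightarrow> ode2 \<Rightarrow> ode2" where
  "pullback_ode R E =
     (\<lambda>t. deriv R t * fst E (R t) - deriv (deriv R) t / deriv R t,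
      \<lambda>t. (deriv R t)\<^sup>2 * snd E (R t))"

lemma solves_at_pullback_ode:
  assumes R: "R analytic_on {t}" and y: "y analytic_on {R t}" and nz: "deriv R t \<noteq> 0"
  shows "solves_at (pullback_ode R E) (y \<circ> R) t \<longleftrightarrow> solves_at E y (R t)"
proof -
  have dR: "deriv R analytic_on {t}" and dy: "deriv y analytic_on {R t}"
    using R y by (auto intro: analytic_deriv)
  have diff: "R field_differentiable at t" "deriv R field_differentiable at t"
             "y field_differentiable at (R t)" "deriv y field_differentiable at (R t)"
    using R y dR dy by (auto intro: analytic_on_imp_differentiable_at)
  have near: "\<forall>\<^sub>F w in nhds x. f analytic_on {w}"
    if f: "f analytic_on {x}" for f :: "complex \<Rightarrow> complex" and x
  proof -
    obtain S where S: "open S" "x \<in> S" "f holomorphic_on S"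
      using f by (auto simp: analytic_at)
    show ?thesis
      using eventually_nhds_in_open[OF S(1,2)] S(1,3)
      by (auto elim!: eventually_mono simp: analytic_at)
  qed
  have "isCont R t"
    using diff(1) by (rule field_differentiable_imp_continuous_at)
  hence "filterlim R (nhds (R t)) (nhds t)"
    by (simp add: isCont_def tendsto_at_iff_tendsto_nhds)
  hence ev_yR: "\<forall>\<^sub>F s in nhds t. y analytic_on {R s}"
    using near[OF y] eventually_compose_filterlim by blast
  note ev_R = near[OF R]
  have "\<forall>\<^sub>F s in nhds t. deriv (y \<circ> R) s = deriv y (R s) * deriv R s"
    using ev_yR ev_R
    by eventually_elim (auto intro!: deriv_chain analytic_on_imp_differentiable_at)
  hence "deriv (deriv (y \<circ> R)) t = deriv (\<lambda>s. (deriv y \<circ> R) s * deriv R s) t"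
    by (intro deriv_cong_ev) auto
  also have "\<dots> = (deriv y \<circ> R) t * deriv (deriv R) t + deriv (deriv y \<circ> R) t * deriv R t"
    by (subst deriv_mult) (auto intro!: field_differentiable_compose diff)
  also have "deriv (deriv y \<circ> R) t = deriv (deriv y) (R t) * deriv R t"
    using diff by (intro deriv_chain) auto
  finally have d2: "deriv (deriv (y \<circ> R)) t =
      deriv y (R t) * deriv (deriv R) t + deriv (deriv y) (R t) * (deriv R t)\<^sup>2"
    by (simp add: power2_eq_square o_def mult.assoc)
  have d1: "deriv (y \<circ> R) t = deriv y (R t) * deriv R t"
    using diff by (intro deriv_chain) auto
  have "deriv (deriv (y \<circ> R)) t + fst (pullback_ode R E) t * deriv (y \<circ> R) t
          + snd (pullback_ode R E) t * (y \<circ> R) t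
        = (deriv R t)\<^sup>2 * (deriv (deriv y) (R t) + fst E (R t) * deriv y (R t)
            + snd E (R t) * y (R t))"
    using nz by (simp add: d1 d2 pullback_ode_def field_simps power2_eq_square)
  thus ?thesis
    using nz by (simp add: solves_at_def)
qed

definition analytic_solution_at_0 :: "ode2 \<Rightarrow> (complex \<Rightarrow> complex) \<Rightarrow> bool" where
  "analytic_solution_at_0 E y \<longleftrightarrow>
     y analytic_on {0} \<and> y 0 = 1 \<and> (\<forall>\<^sub>F z in at 0. solves_at E y z)"

text \<open>For \<open>c\<close> (respectively \<open>\<gamma>\<close>) not a nonpositive integer, such a solution exists and is unique
  as a germ at \<open>0\<close>. The values of the following two functions are therefore meaningful only in
  some neighbourhood of \<open>0\<close>, and they are only ever compared there.\<close>

definition hyp2F1 :: "complex \<Rightarrow> complex \<Rightarrow> complex \<Rightarrow> complex \<Rightarrow> complex" where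
  "hyp2F1 a b c = (SOME y. analytic_solution_at_0 (hypergeometric_ode a b c) y)"

definition Hl ::
  "complex \<Rightarrow> complex \<Rightarrow> complex \<Rightarrow> complex \<Rightarrow> complex \<Rightarrow> complex \<Rightarrow> complex \<Rightarrow> complex" where
  "Hl d q \<alpha> \<beta> \<gamma> \<delta> =
     (SOME u. analytic_solution_at_0 (heun_ode d q \<alpha> \<beta> \<gamma> \<delta> (\<alpha> + \<beta> - \<gamma> - \<delta> + 1)) u)"

definition four_singular_points ::
  "complex \<Rightarrow> complex \<Rightarrow> complex \<Rightarrow> complex \<Rightarrow> complex \<Rightarrow> complex \<Rightarrow> complex \<Rightarrow> bool" where
  "four_singular_points d q \<alpha> \<beta> \<gamma> \<delta> \<epsilon> \<longleftrightarrow>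
     \<not> (\<gamma> = 0 \<and> q = 0) \<and>
     \<not> (\<delta> = 0 \<and> q = \<alpha> * \<beta>) \<and>
     \<not> (\<epsilon> = 0 \<and> q = \<alpha> * \<beta> * d) \<and>
     \<not> (\<alpha> * \<beta> = 0 \<and> \<alpha> + \<beta> = 1 \<and> q = 0)"

text \<open>Rational functions as functions on the complex plane, with value \<open>0\<close> at poles; since the
  fraction is reduced, there are no other exceptional points.\<close>

definition rational_function :: "(complex \<Rightarrow> complex) \<Rightarrow> bool" where
  "rational_function R \<longleftrightarrow>
     (\<exists>N D. D \<noteq> 0 \<and> coprime N D \<and> R = (\<lambda>t. poly N t / poly D t))"

text \<open>A formula \<open>Hl(t) = 2F1(R(t))\<close> induced by a reduction of the equations. The condition that
  \<open>0\<close> is not a pole of \<open>R\<close> excludes the conventional value \<open>R 0 = 0\<close> there. The final equality of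
  the local solutions follows from the other conditions if \<open>\<gamma>\<close> is not a nonpositive integer.\<close>

definition reduces_Hl_to_2F1 ::
  "complex \<Rightarrow> complex \<Rightarrow> complex \<Rightarrow> complex \<Rightarrow> complex \<Rightarrow> complex \<Rightarrow> (complex \<Rightarrow> complex) \<Rightarrow> bool" where
  "reduces_Hl_to_2F1 d q \<alpha> \<beta> \<gamma> \<delta> R \<longleftrightarrow>
     rational_function R \<and> \<not> R constant_on UNIV \<and> \<not> is_pole R 0 \<and> R 0 = 0 \<and>
     (\<exists>a b c. c \<notin> \<int>\<^sub>\<le>\<^sub>0 \<and>
        same_ode (pullback_ode R (hypergeometric_ode a b c))
                 (heun_ode d q \<alpha> \<beta> \<gamma> \<delta> (\<alpha> + \<beta> - \<gamma> - \<delta> + 1)) \<and>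
        (\<forall>\<^sub>F t in nhds 0. Hl d q \<alpha> \<beta> \<gamma> \<delta> t = hyp2F1 a b c (R t)))"

end

theory Submission
  imports Defs "HOL-Computational_Algebra.Fundamental_Theorem_Algebra"
begin

text \<open>
Comparing the coefficients of \<open>u\<close> gives \<open>a b R'\<^sup>2 / (R (R - 1)) = (\<alpha> \<beta> t - q) / T\<close> with
\<open>T = t (t - 1) (t - d)\<close>. The left side has a double pole at every pole of \<open>R\<close>, the right side has
only simple ones, so \<open>R\<close> is a polynomial, of degree \<open>n\<close> say. Then degrees and leading
coefficients force \<open>\<alpha> \<beta> = n\<^sup>2 a b \<noteq> 0\<close> and \<open>n\<^sup>2 (t - p) R (R - 1) = T R'\<^sup>2\<close> with
\<open>p = q / (\<alpha> \<beta>)\<close>.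

Combined with the coefficients of \<open>u'\<close> and the presence of four singular points, this yields
\<open>R(p) \<in> {0, 1}\<close>. Let \<open>Q\<close> be \<open>R\<close> or \<open>1 - R\<close>, so that \<open>Q(p) = 0\<close>. The exponent difference at
\<open>z = 0\<close> (for \<open>Q\<close>) cannot be \<open>1/2\<close>, and hence every zero of \<open>Q\<close> other than \<open>p\<close> is one of
\<open>0, 1, d\<close>, and simple; \<open>p\<close> is a double zero if it is one of \<open>0, 1, d\<close>, and a triple zero
otherwise. This leaves finitely many shapes of \<open>Q\<close>; for each of them the differential equation
becomes a polynomial identity in \<open>u = t - p\<close>, whose coefficients determine \<open>d\<close> and \<open>p\<close>.
\<close>

section \<open>Coefficient comparison\<close>

text \<open>The hypotheses of \<open>coefficients_m_j\<close> are \<open>n\<^sup>2 (Q - 1) = C B (m H + u H')\<^sup>2\<close>, where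
  \<open>Q = C u\<^sup>m H\<close> has a zero of order \<open>m\<close> at \<open>u = 0\<close> and \<open>j\<close> simple zeros, \<open>n = m + j\<close>, and \<open>B\<close>
  collects the remaining singular points. The lemmas \<open>case_m_j\<close> follow the same indexing.\<close>

lemma coefficients_2_0:
  fixes C r s :: complex
  assumes eq: "\<And>u. 4 * (C * u^2 - 1) = C * ((u - r) * (u - s)) * 2^2"
    and "C \<noteq> 0"
  shows "r + s = 0"
proof -
  \<comment> \<open>Here and in the next lemmas \<open>?c\<close> is the left side of
    \<open>eq\<close> minus the right one, expanded in powers of \<open>u\<close>. The factor
    \<open>n^2\<close> makes the top terms cancel; the claims come from the highest surviving
    coefficients.\<close>
  let ?c = "[:- 4 - 4 * C * (r * s), 4 * C * (r + s):]"
  have "poly ?c = poly 0"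
  proof
    fix u
    show "poly ?c u = poly 0 u"
      unfolding poly_pCons poly_0 using eq[of u] by algebra
  qed
  hence "?c = 0"
    by (simp only: poly_eq_poly_eq_iff)
  thus "r + s = 0"
    using \<open>C \<noteq> 0\<close> by (simp del: distrib_left_numeral)
qed

lemma coefficients_2_1:
  fixes C r s :: complex
  assumes eq: "\<And>u. 9 * (C * u^2 * (u - r) - 1) = C * (u - s) * (2 * (u - r) + u)^2"
    and "C \<noteq> 0"
  shows "r + 3 * s = 0"
proof -
  let ?c = "[:- 9 + 4 * C * r^2 * s, - C * (4 * r^2 + 12 * r * s), 3 * C * (r + 3 * s):]"
  have "poly ?c = poly 0"
  proof
    fix u
    show "poly ?c u = poly 0 u"
      unfolding poly_pCons poly_0 using eq[of u] by algebra
  qed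
  hence "?c = 0"
    by (simp only: poly_eq_poly_eq_iff)
  thus "r + 3 * s = 0"
    using \<open>C \<noteq> 0\<close> by (simp del: distrib_left_numeral)
qed

lemma coefficients_2_2:
  fixes C r s :: complex
  assumes eq: "\<And>u. 16 * (C * u^2 * ((u - r) * (u - s)) - 1) =
      C * (2 * ((u - r) * (u - s)) + u * ((u - r) + (u - s)))^2"
    and "C \<noteq> 0"
  shows "r + s = 0"
proof -
  let ?c = "[:- 16 - 4 * C * (r * s)^2, 12 * C * (r + s) * (r * s), - 9 * C * (r + s)^2,
    8 * C * (r + s):]"
  have "poly ?c = poly 0"
  proof
    fix u
    show "poly ?c u = poly 0 u"
      unfolding poly_pCons poly_0 using eq[of u] by algebra
  qed
  hence "?c = 0"
    by (simp only: poly_eq_poly_eq_iff)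
  thus "r + s = 0"
    using \<open>C \<noteq> 0\<close> by (simp del: distrib_left_numeral)
qed

lemma coefficients_3_0:
  fixes C r s t :: complex
  assumes eq: "\<And>u. 9 * (C * u^3 - 1) = C * ((u - r) * (u - s) * (u - t)) * 3^2"
    and "C \<noteq> 0"
  shows "r + s + t = 0" "r * s + r * t + s * t = 0"
proof -
  let ?c = "[:- 9 + 9 * C * (r * s * t), - 9 * C * (r * s + r * t + s * t), 9 * C * (r + s + t):]"
  have "poly ?c = poly 0"
  proof
    fix u
    show "poly ?c u = poly 0 u"
      unfolding poly_pCons poly_0 using eq[of u] by algebra
  qed
  hence "?c = 0"
    by (simp only: poly_eq_poly_eq_iff)
  thus "r + s + t = 0" "r * s + r * t + s * t = 0"
    using \<open>C \<noteq> 0\<close> by (simp_all del: distrib_left_numeral)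
qed

lemma coefficients_3_1:
  fixes C r s t :: complex
  assumes eq: "\<And>u. 16 * (C * u^3 * (u - r) - 1) =
      C * ((u - s) * (u - t)) * (3 * (u - r) + u)^2"
    and "C \<noteq> 0"
  shows "r + 2 * (s + t) = 0" "16 * (s * t) = 3 * r^2"
proof -
  let ?c = "[:- 16 - 9 * C * r^2 * (s * t), C * (9 * r^2 * (s + t) + 24 * r * (s * t)),
    - C * (9 * r^2 + 24 * r * (s + t) + 16 * (s * t)), 8 * C * (r + 2 * (s + t)):]"
  have "poly ?c = poly 0"
  proof
    fix u
    show "poly ?c u = poly 0 u"
      unfolding poly_pCons poly_0 using eq[of u] by algebra
  qed
  hence "?c = 0"
    by (simp only: poly_eq_poly_eq_iff)
  hence "r + 2 * (s + t) = 0" "9 * r^2 + 24 * r * (s + t) + 16 * (s * t) = 0"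
    using \<open>C \<noteq> 0\<close> by (simp_all del: distrib_left_numeral)
  thus "r + 2 * (s + t) = 0" "16 * (s * t) = 3 * r^2"
    by algebra+
qed

lemma coefficients_3_2:
  fixes C r s t :: complex
  assumes eq: "\<And>u. 25 * (C * u^3 * ((u - s) * (u - t)) - 1) =
      C * (u - r) * (3 * ((u - s) * (u - t)) + u * ((u - s) + (u - t)))^2"
    and "C \<noteq> 0"
  shows "5 * r + 3 * (s + t) = 0" "5 * (s * t) = 8 * (s + t)^2"
proof -
  let ?c = "[:- 25 + 9 * C * r * (s * t)^2,
    - C * (9 * (s * t)^2 + 24 * (s + t) * (s * t) * r),
    C * (24 * (s + t) * (s * t) + r * (16 * (s + t)^2 + 30 * (s * t))),
    - C * (16 * (s + t)^2 + 5 * (s * t) + 40 * (s + t) * r), 5 * C * (5 * r + 3 * (s + t)):]"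
  have "poly ?c = poly 0"
  proof
    fix u
    show "poly ?c u = poly 0 u"
      unfolding poly_pCons poly_0 using eq[of u] by algebra
  qed
  hence "?c = 0"
    by (simp only: poly_eq_poly_eq_iff)
  hence "5 * r + 3 * (s + t) = 0" "16 * (s + t)^2 + 5 * (s * t) + 40 * (s + t) * r = 0"
    using \<open>C \<noteq> 0\<close> by (simp_all del: distrib_left_numeral)
  thus "5 * r + 3 * (s + t) = 0" "5 * (s * t) = 8 * (s + t)^2"
    by algebra+
qed

lemma coefficients_3_3:
  fixes C r s t :: complex
  assumes eq: "\<And>u. 36 * (C * u^3 * ((u - r) * (u - s) * (u - t)) - 1) =
      C * (3 * ((u - r) * (u - s) * (u - t)) +
        u * ((u - s) * (u - t) + (u - r) * (u - t) + (u - r) * (u - s)))^2"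
    and "C \<noteq> 0"
  shows "r + s + t = 0" "r * s + r * t + s * t = 0"
proof -
  let ?c = "[:- 36 - 9 * C * (r * s * t)^2, 24 * C * (r * s + r * t + s * t) * (r * s * t),
    - C * (16 * (r * s + r * t + s * t)^2 + 30 * (r + s + t) * (r * s * t)),
    40 * C * (r + s + t) * (r * s + r * t + s * t),
    - C * (25 * (r + s + t)^2 + 12 * (r * s + r * t + s * t)), 24 * C * (r + s + t):]"
  have "poly ?c = poly 0"
  proof
    fix u
    show "poly ?c u = poly 0 u"
      unfolding poly_pCons poly_0 using eq[of u] by algebra
  qed
  hence "?c = 0"
    by (simp only: poly_eq_poly_eq_iff)
  thus "r + s + t = 0" "r * s + r * t + s * t = 0"
    using \<open>C \<noteq> 0\<close> by (auto simp del: distrib_left_numeral)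
qed

section \<open>Polynomial reductions\<close>

text \<open>Orders are additive and \<open>B\<close> contributes nothing at
  \<open>a\<close>.\<close>

lemma linear_power_dvd_mult_cancel:
  fixes A B :: "complex poly"
  assumes "[:-a, 1:] ^ n dvd A * B" and "poly B a \<noteq> 0"
  shows "[:-a, 1:] ^ n dvd A"
proof -
  have "A * B \<noteq> 0 \<and> order a (A * B) = order a A" if "A \<noteq> 0"
    using that assms(2) by (subst order_mult) (auto simp: order_0I)
  thus ?thesis
    using assms by (cases "A = 0") (auto simp: order_divides)
qed

text \<open>\<open>W\<close> is the last factor in the assumption \<open>F\<close> of the locale
  below. If \<open>T\<close> is nonzero at \<open>p\<close>, then \<open>W\<close> takes the same
  value there. If \<open>p\<close> is a simple zero, then with \<open>X = [:-p, 1:]\<close> the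
  difference \<open>T - X * pderiv T\<close> is divisible by \<open>X ^ 2\<close>, so
  \<open>W\<close> agrees with \<open>2 * X * G\<close> modulo \<open>X ^ 2\<close>.\<close>

lemma not_linear_power_dvd:
  fixes T G :: "complex poly" and p :: complex
  defines "W \<equiv> 2 * [:-p, 1:] * G + T - [:-p, 1:] * pderiv T"
  assumes T: "rsquarefree T" and G: "poly T p = 0 \<Longrightarrow> poly G p \<noteq> 0"
  shows "\<not> [:-p, 1:] ^ Suc (order p T) dvd W"
proof (cases "poly T p = 0")
  case False
  hence "poly W p \<noteq> 0"
    by (simp add: W_def)
  with False show ?thesis
    by (simp add: order_0I flip: poly_eq_0_iff_dvd)
next
  case True
  then obtain T1 where T1: "T = [:-p, 1:] * T1"
    by (auto simp: poly_eq_0_iff_dvd)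
  have "order p T = 1"
    using T True by (intro rsquarefree_root_order) (auto simp: rsquarefree_def)
  moreover have False if "[:-p, 1:] ^ 2 dvd W"
  proof -
    define X where "X = [:-p, 1:]"
    have [simp]: "pderiv X = 1"
      by (simp add: X_def pderiv_pCons)
    have "X * (2 * G) = W + X ^ 2 * pderiv T1"
      unfolding W_def T1 X_def[symmetric] by (simp add: pderiv_mult) algebra
    with that have "[:-p, 1:] ^ 2 dvd [:-p, 1:] * (2 * G)"
      by (simp only: X_def dvd_add dvd_triv_left)
    hence "[:-p, 1:] dvd 2 * G"
      unfolding power2_eq_square by (subst (asm) dvd_mult_cancel_left) auto
    hence "poly (2 * G) p = 0"
      by (simp only: poly_eq_0_iff_dvd)
    with G True show False
      by simp
  qed
  ultimately show ?thesis
    by (auto simp: numeral_2_eq_2)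
qed

text \<open>For a polynomial substitution \<open>z = Q(t)\<close>, the equations \<open>E\<close> and \<open>F\<close> amount to the
  equality of the coefficients of \<open>u\<close> and \<open>u'\<close>; in \<open>F\<close> the second derivative of \<open>Q\<close> has been
  eliminated by means of the derivative of \<open>E\<close>. The exponents are \<open>0, 1 - c\<close> at \<open>z = 0\<close>
  and \<open>0, 1 - e\<close> at \<open>z = 1\<close>, and \<open>G / T\<close> is the coefficient of \<open>u'\<close> in the Heun equation.
  The exchange of \<open>z = 0\<close> and \<open>z = 1\<close> is a symmetry.\<close>

locale polynomial_reduction =
  fixes Q T G :: "complex poly" and p c e :: complex
  assumes T: "rsquarefree T" and degree_pos: "degree Q > 0"
    and G: "poly T p = 0 \<Longrightarrow> poly G p \<noteq> 0"
    and E: "smult (of_nat (degree Q) ^ 2) ([:-p, 1:] * Q * (Q - 1)) = T * pderiv Q ^ 2"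
    and F: "T * pderiv Q * [:-p, 1:] * (smult (2*c - 1) (Q - 1) + smult (2*e - 1) Q) =
            Q * (Q - 1) * (2 * [:-p, 1:] * G + T - [:-p, 1:] * pderiv T)"
begin

section \<open>Zeros of \<open>Q\<close> and their orders\<close>

lemma nonzero: "Q \<noteq> 0" "pderiv Q \<noteq> 0" "Q \<noteq> 1" "T \<noteq> 0"
  using degree_pos T by (auto simp: pderiv_eq_0_iff rsquarefree_def)

lemma pole_dvd: "[:-p, 1:] ^ Suc (order p T) dvd T * [:-p, 1:]"
  by (simp only: power_Suc2) (intro mult_dvd_mono order_1 dvd_refl)

text \<open>Otherwise \<open>Q * (Q - 1)\<close> is nonzero at \<open>p\<close>, and the
  divisibility of the left side of \<open>F\<close> given by \<open>pole_dvd\<close> passes to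
  \<open>W\<close>, against \<open>not_linear_power_dvd\<close>.\<close>

lemma value_at_p: "poly Q p = 0 \<or> poly Q p = 1"
proof (rule ccontr)
  assume *: "\<not> ?thesis"
  have "[:-p, 1:] ^ Suc (order p T) dvd
          (2 * [:-p, 1:] * G + T - [:-p, 1:] * pderiv T) * (Q * (Q - 1))"
  proof -
    have "[:-p, 1:] ^ Suc (order p T) dvd
        T * [:-p, 1:] * (pderiv Q * (smult (2*c - 1) (Q - 1) + smult (2*e - 1) Q))"
      by (intro dvd_mult2 pole_dvd)
    thus ?thesis
      using F by (simp only: mult_ac)
  qed
  hence "[:-p, 1:] ^ Suc (order p T) dvd 2 * [:-p, 1:] * G + T - [:-p, 1:] * pderiv T"
    by (rule linear_power_dvd_mult_cancel) (use * in simp)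
  with not_linear_power_dvd[OF T G] show False
    by blast
qed

context
  assumes Qp: "poly Q p = 0"
begin

text \<open>For \<open>2 * c = 1\<close> the bracket in \<open>F\<close> is a multiple of
  \<open>Q\<close>. Cancelling \<open>Q\<close> leaves beside \<open>W\<close> only
  \<open>Q - 1\<close>, which is \<open>-1\<close> at \<open>p\<close>, and the argument of
  \<open>value_at_p\<close> applies again.\<close>

lemma exponent_nontrivial: "2 * c - 1 \<noteq> 0"
proof
  assume "2 * c - 1 = 0"
  with F have "T * pderiv Q * [:-p, 1:] * ([:2*e - 1:] * Q) =
      Q * (Q - 1) * (2 * [:-p, 1:] * G + T - [:-p, 1:] * pderiv T)"
    by (simp only: smult_0_left add_0_left) simp
  hence "(T * [:-p, 1:] * (pderiv Q * [:2*e - 1:])) * Q =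
      (2 * [:-p, 1:] * G + T - [:-p, 1:] * pderiv T) * (Q - 1) * Q"
    by (simp only: mult_ac)
  hence *: "T * [:-p, 1:] * (pderiv Q * [:2*e - 1:]) =
      (2 * [:-p, 1:] * G + T - [:-p, 1:] * pderiv T) * (Q - 1)"
    using nonzero by (subst (asm) mult_cancel_right) auto
  have "[:-p, 1:] ^ Suc (order p T) dvd
          (2 * [:-p, 1:] * G + T - [:-p, 1:] * pderiv T) * (Q - 1)"
    unfolding *[symmetric] by (intro dvd_mult2 pole_dvd)
  hence "[:-p, 1:] ^ Suc (order p T) dvd 2 * [:-p, 1:] * G + T - [:-p, 1:] * pderiv T"
    by (rule linear_power_dvd_mult_cancel) (use Qp in simp)
  with not_linear_power_dvd[OF T G] show False
    by blast
qed

text \<open>At a zero of \<open>Q\<close> of order \<open>k + 1\<close> the right side of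
  \<open>F\<close> vanishes at least to that order. If \<open>T\<close> is nonzero there, the left
  side vanishes only to order \<open>k\<close>, because the bracket has the value
  \<open>-(2 * c - 1)\<close>, nonzero by \<open>exponent_nontrivial\<close>.\<close>

lemma root_singular:
  assumes "poly Q z = 0" and "z \<noteq> p"
  shows "poly T z = 0"
proof (rule ccontr)
  assume Tz: "poly T z \<noteq> 0"
  define k where "k = order z (pderiv Q)"
  have k: "order z Q = Suc k"
    unfolding k_def by (rule order_pderiv) (use nonzero assms in auto)
  have "[:-z, 1:] ^ Suc k dvd Q"
    using order_1[of z Q] k by simp
  hence "[:-z, 1:] ^ Suc k dvd pderiv Q *
      (T * [:-p, 1:] * (smult (2*c - 1) (Q - 1) + smult (2*e - 1) Q))"
  proof -
    assume "[:-z, 1:] ^ Suc k dvd Q"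
    hence "[:-z, 1:] ^ Suc k dvd
        Q * ((Q - 1) * (2 * [:-p, 1:] * G + T - [:-p, 1:] * pderiv T))"
      by (rule dvd_mult2)
    thus ?thesis
      using F by (simp only: mult_ac)
  qed
  hence "[:-z, 1:] ^ Suc k dvd pderiv Q"
    by (rule linear_power_dvd_mult_cancel) (use Tz assms exponent_nontrivial in auto)
  thus False
    using nonzero by (simp add: order_divides k_def del: power_Suc)
qed

text \<open>If \<open>Q\<close> has order \<open>m\<close> at \<open>z\<close>, then
  \<open>E\<close> gives \<open>m = order z T + 2 * (m - 1)\<close> for \<open>z\<close> other than
  \<open>p\<close>; at \<open>p\<close> the left side is \<open>m + 1\<close>.\<close>

lemma order_root_eq:
  assumes "poly Q z = 0"
  shows "order z Q + order z T = (if z = p then 3 else 2)"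
proof -
  define k where "k = order z (pderiv Q)"
  have k: "order z Q = Suc k"
    unfolding k_def by (rule order_pderiv) (use nonzero assms in auto)
  have "order z (smult (of_nat (degree Q) ^ 2) ([:-p, 1:] * Q * (Q - 1))) =
      order z [:-p, 1:] + order z Q"
  proof -
    have "[:-p, 1:] * Q \<noteq> 0" "Q - 1 \<noteq> 0" "poly (Q - 1) z \<noteq> 0"
      using nonzero assms by (simp_all del: mult_pCons_left)
    thus ?thesis
      using degree_pos by (subst order_smult) (simp, simp only: order_mult no_zero_divisors
        order_0I add_0_right not_False_eq_True)
  qed
  also have "order z [:-p, 1:] = (if z = p then 1 else 0)"
    using order_power_n_n[of p 1] by (auto intro: order_0I)
  also have "order z (smult (of_nat (degree Q) ^ 2) ([:-p, 1:] * Q * (Q - 1))) = order z T + 2 * k"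
    unfolding E using nonzero by (simp add: order_mult k_def power2_eq_square)
  finally show ?thesis
    using k T by (auto simp: rsquarefree_def split: if_splits)
qed

text \<open>Zeros of \<open>Q\<close> other than \<open>p\<close> are simple zeros of
  \<open>T\<close> by \<open>root_singular\<close>, hence simple for \<open>Q\<close> by
  \<open>order_root_eq\<close>, which also yields the exponent at \<open>p\<close>.\<close>

lemma decomposition:
  obtains C A where "C \<noteq> 0" "A \<subseteq> {z. poly T z = 0}" "p \<notin> A"
    "Q = smult C ([:-p, 1:] ^ (3 - order p T) * (\<Prod>z\<in>A. [:-z, 1:]))"
proof -
  define A where "A = {z. poly Q z = 0} - {p}"
  have sub: "A \<subseteq> {z. poly T z = 0}"
    using root_singular by (auto simp: A_def)
  have simple: "order z Q = 1" if "z \<in> A" for z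
  proof -
    have "order z T = 1"
      using that sub T nonzero by (intro rsquarefree_root_order) auto
    thus ?thesis
      using order_root_eq[of z] that by (auto simp: A_def)
  qed
  have "Q = smult (lead_coeff Q) (\<Prod>z\<in>{z. poly Q z = 0}. [:-z, 1:] ^ order z Q)"
    by (rule complex_poly_decompose[symmetric])
  also have "(\<Prod>z\<in>{z. poly Q z = 0}. [:-z, 1:] ^ order z Q) =
      [:-p, 1:] ^ order p Q * (\<Prod>z\<in>A. [:-z, 1:] ^ order z Q)"
    unfolding A_def using Qp nonzero by (intro prod.remove) (auto intro: poly_roots_finite)
  also have "(\<Prod>z\<in>A. [:-z, 1:] ^ order z Q) = (\<Prod>z\<in>A. [:-z, 1:])"
    by (intro prod.cong refl) (simp add: simple)
  also have "order p Q = 3 - order p T"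
    using order_root_eq[OF Qp] by simp
  finally have Q_eq: "Q = smult (lead_coeff Q)
    ([:-p, 1:] ^ (3 - order p T) * (\<Prod>z\<in>A. [:-z, 1:]))" .
  show ?thesis
    by (rule that[OF _ sub _ Q_eq]) (use nonzero in \<open>auto simp: A_def\<close>)
qed

end

text \<open>In the applications \<open>H\<close> collects the zeros of \<open>Q\<close> other than
  \<open>p\<close>, and \<open>B\<close> the singular points that are not zeros of \<open>Q\<close>.
  Both sides of \<open>E\<close> contain \<open>C * X ^ (m + 1) * H\<close>: on the right,
  \<open>3 - m\<close> factors \<open>X\<close> come from \<open>T\<close> and
  \<open>2 * (m - 1)\<close> from the squared derivative. After cancelling, \<open>u = t - p\<close>
  moves \<open>p\<close> to the origin.\<close>

lemma reduced_equation:
  fixes H B :: "complex poly"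
  assumes Q: "Q = smult C ([:-p, 1:] ^ m * H)" and m: "m = 2 \<or> m = 3"
    and TH: "T = [:-p, 1:] ^ (3 - m) * (H * B)"
  shows "degree Q = m + degree H" (is ?degree)
    and "of_nat (degree Q) ^ 2 * (C * u ^ m * poly H (u + p) - 1) =
         C * poly B (u + p) * (of_nat m * poly H (u + p) + u * poly (pderiv H) (u + p)) ^ 2"
proof -
  define X where "X = [:-p, 1:]"
  have [simp]: "pderiv X = 1" "X \<noteq> 0"
    by (simp_all add: X_def pderiv_pCons)
  define K where "K = of_nat m * H + X * pderiv H"
  have nz: "C \<noteq> 0" "H \<noteq> 0"
    using nonzero Q by auto
  have Q': "Q = [:C:] * (X ^ m * H)"
    by (simp add: Q X_def)
  show ?degree
    using nz by (simp add: Q degree_mult_eq degree_power_eq del: mult_pCons_left)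
  have dQ: "pderiv Q = [:C:] * (X ^ (m - 1) * K)"
    using m unfolding Q' K_def
    by (auto simp: pderiv_mult pderiv_power_Suc pderiv_smult smult_add_right algebra_simps
        eval_nat_numeral)
  have "[:of_nat (degree Q) ^ 2:] * (X * Q * (Q - 1)) = T * pderiv Q ^ 2"
    using E by (simp add: X_def)
  hence "[:of_nat (degree Q) ^ 2:] * (X * ([:C:] * (X ^ m * H)) * (Q - 1)) =
         X ^ (3 - m) * (H * B) * ([:C:] * (X ^ (m - 1) * K)) ^ 2"
    by (simp only: dQ TH[folded X_def] flip: Q')
  hence "([:C:] * X ^ (m + 1) * H) * ([:of_nat (degree Q) ^ 2:] * (Q - 1)) =
         ([:C:] * X ^ (m + 1) * H) * ([:C:] * B * K ^ 2)"
    using m by (elim disjE) (simp_all add: eval_nat_numeral mult_ac)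
  hence "[:of_nat (degree Q) ^ 2:] * (Q - 1) = [:C:] * B * K ^ 2"
    by (rule mult_left_cancel[THEN iffD1, rotated]) (use nz in auto)
  hence "poly ([:of_nat (degree Q) ^ 2:] * (Q - 1)) (u + p) = poly ([:C:] * B * K ^ 2) (u + p)"
    by (rule arg_cong)
  thus "of_nat (degree Q) ^ 2 * (C * u ^ m * poly H (u + p) - 1) =
         C * poly B (u + p) * (of_nat m * poly H (u + p) + u * poly (pderiv H) (u + p)) ^ 2"
    by (simp add: Q K_def X_def algebra_simps)
qed

end

text \<open>\<open>r\<close>, \<open>s\<close>, \<open>t\<close> are the points \<open>0\<close>, \<open>1\<close>, \<open>d\<close> in some order and \<open>Q\<close> has a triple zero at \<open>p\<close>;
  in the quartic case the other zero is \<open>r\<close>, in the quintic case the other zeros are \<open>s\<close> and \<open>t\<close>.\<close>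

definition heun_quartic :: "complex \<Rightarrow> complex \<Rightarrow> complex \<Rightarrow> complex \<Rightarrow> bool" where
  "heun_quartic p r s t \<longleftrightarrow>
     (r - p) + 2 * ((s - p) + (t - p)) = 0 \<and> 16 * ((s - p) * (t - p)) = 3 * (r - p)^2"

definition heun_quintic :: "complex \<Rightarrow> complex \<Rightarrow> complex \<Rightarrow> complex \<Rightarrow> bool" where
  "heun_quintic p r s t \<longleftrightarrow>
     5 * (r - p) + 3 * ((s - p) + (t - p)) = 0 \<and>
     5 * ((s - p) * (t - p)) = 8 * ((s - p) + (t - p))^2"

section \<open>The possible shapes of \<open>Q\<close>\<close>

lemmas poly_linear_simps = poly_mult poly_add poly_pCons poly_0 poly_1 pderiv_mult pderiv_pCons
  pderiv_0 pderiv_1 of_nat_numeral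

context polynomial_reduction
begin

text \<open>This and the following \<open>case\<close> lemmas bring \<open>T\<close> into the form
  required by \<open>reduced_equation\<close>; in the coordinate \<open>u = t - p\<close> the
  singular points become \<open>r - p\<close>, \<open>s - p\<close> and
  \<open>t - p\<close>.\<close>

lemma case_2_0:
  assumes Q: "Q = smult C ([:-p, 1:] ^ 2 * 1)"
    and T: "T = [:-p, 1:] * (1 * ([:-r, 1:] * [:-s, 1:]))"
  shows "degree Q = 2 \<and> (r - p) + (s - p) = 0"
proof -
  have "C \<noteq> 0"
    using Q nonzero by auto
  have T': "T = [:-p, 1:] ^ (3 - 2) * (1 * ([:-r, 1:] * [:-s, 1:]))"
    by (simp add: T)
  have "(2::nat) = 2 \<or> (2::nat) = 3"
    by simp
  note eq = reduced_equation[OF Q this T']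
  have deg: "degree Q = 2"
    using eq(1) by simp
  have "4 * (C * u^2 - 1) = C * ((u - (r - p)) * (u - (s - p))) * 2^2" for u
    using eq(2)[of u, unfolded deg] by (simp only: poly_linear_simps) algebra
  from coefficients_2_0[OF this \<open>C \<noteq> 0\<close>] deg show ?thesis
    by simp
qed

lemma case_2_1:
  assumes Q: "Q = smult C ([:-p, 1:] ^ 2 * [:-r, 1:])"
    and T: "T = [:-p, 1:] * ([:-r, 1:] * [:-s, 1:])"
  shows "degree Q = 3 \<and> (r - p) + 3 * (s - p) = 0"
proof -
  have "C \<noteq> 0"
    using Q nonzero by auto
  have T': "T = [:-p, 1:] ^ (3 - 2) * ([:-r, 1:] * [:-s, 1:])"
    by (simp add: T)
  have "(2::nat) = 2 \<or> (2::nat) = 3"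
    by simp
  note eq = reduced_equation[OF Q this T']
  have deg: "degree Q = 3"
    using eq(1) by simp
  have "9 * (C * u^2 * (u - (r - p)) - 1) = C * (u - (s - p)) * (2 * (u - (r - p)) + u)^2" for u
    using eq(2)[of u, unfolded deg] by (simp only: poly_linear_simps) algebra
  from coefficients_2_1[OF this \<open>C \<noteq> 0\<close>] deg show ?thesis
    by simp
qed

lemma case_2_2:
  assumes Q: "Q = smult C ([:-p, 1:] ^ 2 * ([:-r, 1:] * [:-s, 1:]))"
    and T: "T = [:-p, 1:] * (([:-r, 1:] * [:-s, 1:]) * 1)"
  shows "degree Q = 4 \<and> (r - p) + (s - p) = 0"
proof -
  have "C \<noteq> 0"
    using Q nonzero by auto
  have T': "T = [:-p, 1:] ^ (3 - 2) * (([:-r, 1:] * [:-s, 1:]) * 1)"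
    by (simp add: T)
  have "(2::nat) = 2 \<or> (2::nat) = 3"
    by simp
  note eq = reduced_equation[OF Q this T']
  have deg: "degree Q = 4"
    using eq(1) by simp
  have "16 * (C * u^2 * ((u - (r - p)) * (u - (s - p))) - 1) =
      C * (2 * ((u - (r - p)) * (u - (s - p))) + u * ((u - (r - p)) + (u - (s - p))))^2" for u
    using eq(2)[of u, unfolded deg] by (simp only: poly_linear_simps) algebra
  from coefficients_2_2[OF this \<open>C \<noteq> 0\<close>] deg show ?thesis
    by simp
qed

lemma case_3_0:
  assumes Q: "Q = smult C ([:-p, 1:] ^ 3 * 1)"
    and T: "T = 1 * ([:-r, 1:] * [:-s, 1:] * [:-t, 1:])"
  shows "degree Q = 3 \<and> (r - p) + (s - p) + (t - p) = 0 \<and>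
    (r - p) * (s - p) + (r - p) * (t - p) + (s - p) * (t - p) = 0"
proof -
  have "C \<noteq> 0"
    using Q nonzero by auto
  have T': "T = [:-p, 1:] ^ (3 - 3) * (1 * ([:-r, 1:] * [:-s, 1:] * [:-t, 1:]))"
    by (simp add: T)
  have "(3::nat) = 2 \<or> (3::nat) = 3"
    by simp
  note eq = reduced_equation[OF Q this T']
  have deg: "degree Q = 3"
    using eq(1) by simp
  have "9 * (C * u^3 - 1) = C * ((u - (r - p)) * (u - (s - p)) * (u - (t - p))) * 3^2" for u
    using eq(2)[of u, unfolded deg] by (simp only: poly_linear_simps) algebra
  from coefficients_3_0[OF this \<open>C \<noteq> 0\<close>] deg show ?thesis
    by simp
qed

lemma case_3_1:
  assumes Q: "Q = smult C ([:-p, 1:] ^ 3 * [:-r, 1:])"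
    and T: "T = [:-r, 1:] * ([:-s, 1:] * [:-t, 1:])"
  shows "degree Q = 4 \<and> heun_quartic p r s t"
proof -
  have "C \<noteq> 0"
    using Q nonzero by auto
  have T': "T = [:-p, 1:] ^ (3 - 3) * ([:-r, 1:] * ([:-s, 1:] * [:-t, 1:]))"
    by (simp add: T)
  have "(3::nat) = 2 \<or> (3::nat) = 3"
    by simp
  note eq = reduced_equation[OF Q this T']
  have deg: "degree Q = 4"
    using eq(1) by simp
  have "16 * (C * u^3 * (u - (r - p)) - 1) =
      C * ((u - (s - p)) * (u - (t - p))) * (3 * (u - (r - p)) + u)^2" for u
    using eq(2)[of u, unfolded deg] by (simp only: poly_linear_simps) algebra
  from coefficients_3_1[OF this \<open>C \<noteq> 0\<close>] deg show ?thesis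
    by (simp add: heun_quartic_def)
qed

lemma case_3_2:
  assumes Q: "Q = smult C ([:-p, 1:] ^ 3 * ([:-s, 1:] * [:-t, 1:]))"
    and T: "T = ([:-s, 1:] * [:-t, 1:]) * [:-r, 1:]"
  shows "degree Q = 5 \<and> heun_quintic p r s t"
proof -
  have "C \<noteq> 0"
    using Q nonzero by auto
  have T': "T = [:-p, 1:] ^ (3 - 3) * (([:-s, 1:] * [:-t, 1:]) * [:-r, 1:])"
    by (simp add: T)
  have "(3::nat) = 2 \<or> (3::nat) = 3"
    by simp
  note eq = reduced_equation[OF Q this T']
  have deg: "degree Q = 5"
    using eq(1) by simp
  have "25 * (C * u^3 * ((u - (s - p)) * (u - (t - p))) - 1) =
      C * (u - (r - p)) * (3 * ((u - (s - p)) * (u - (t - p))) +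
        u * ((u - (s - p)) + (u - (t - p))))^2" for u
    using eq(2)[of u, unfolded deg] by (simp only: poly_linear_simps) algebra
  from coefficients_3_2[OF this \<open>C \<noteq> 0\<close>] deg show ?thesis
    by (simp add: heun_quintic_def)
qed

lemma case_3_3:
  assumes Q: "Q = smult C ([:-p, 1:] ^ 3 * ([:-r, 1:] * [:-s, 1:] * [:-t, 1:]))"
    and T: "T = ([:-r, 1:] * [:-s, 1:] * [:-t, 1:]) * 1"
  shows "degree Q = 6 \<and> (r - p) + (s - p) + (t - p) = 0 \<and>
    (r - p) * (s - p) + (r - p) * (t - p) + (s - p) * (t - p) = 0"
proof -
  have "C \<noteq> 0"
    using Q nonzero by auto
  have T': "T = [:-p, 1:] ^ (3 - 3) * (([:-r, 1:] * [:-s, 1:] * [:-t, 1:]) * 1)"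
    by (simp add: T)
  have "(3::nat) = 2 \<or> (3::nat) = 3"
    by simp
  note eq = reduced_equation[OF Q this T']
  have deg: "degree Q = 6"
    using eq(1) by simp
  have "36 * (C * u^3 * ((u - (r - p)) * (u - (s - p)) * (u - (t - p))) - 1) =
      C * (3 * ((u - (r - p)) * (u - (s - p)) * (u - (t - p))) +
        u * ((u - (s - p)) * (u - (t - p)) + (u - (r - p)) * (u - (t - p)) + (u - (r - p)) * (u - (s - p))))^2" for u
    using eq(2)[of u, unfolded deg] by (simp only: poly_linear_simps) algebra
  from coefficients_3_3[OF this \<open>C \<noteq> 0\<close>] deg show ?thesis
    by simp
qed

text \<open>Since \<open>p\<close> is a simple zero of \<open>T\<close>, it is a double zero of
  \<open>Q\<close>, and the other zeros form a subset of \<open>{r, s}\<close>. The empty and the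
  full subset give the same relation; the two singletons differ by exchanging \<open>r\<close> and
  \<open>s\<close>.\<close>

lemma singular_case:
  assumes Qp: "poly Q p = 0" and T_eq: "T = [:-p, 1:] * ([:-r, 1:] * [:-s, 1:])"
    and dist: "p \<noteq> r" "p \<noteq> s" "r \<noteq> s"
  shows "degree Q \<in> {2, 4} \<and> (r - p) + (s - p) = 0 \<or>
    degree Q = 3 \<and> ((r - p) + 3 * (s - p) = 0 \<or> (s - p) + 3 * (r - p) = 0)"
proof -
  have "order p T = 1"
    using T nonzero by (intro rsquarefree_root_order) (auto simp: T_eq)
  moreover obtain C A where A: "A \<subseteq> {z. poly T z = 0}" "p \<notin> A"
      and "Q = smult C ([:-p, 1:] ^ (3 - order p T) * (\<Prod>z\<in>A. [:-z, 1:]))"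
    using decomposition[OF Qp] by blast
  ultimately have Q: "Q = smult C ([:-p, 1:] ^ 2 * (\<Prod>z\<in>A. [:-z, 1:]))"
    by simp
  have "poly T z = 0 \<longleftrightarrow> z \<in> {p, r, s}" for z
    unfolding T_eq poly_mult by auto
  with A have "A \<in> {{}, {r}, {s}, {r, s}}"
    by auto
  moreover have "T = [:-p, 1:] * ([:-s, 1:] * [:-r, 1:])"
    "T = [:-p, 1:] * (([:-r, 1:] * [:-s, 1:]) * 1)" "T = [:-p, 1:] * (1 * ([:-r, 1:] * [:-s, 1:]))"
    by (simp_all only: T_eq mult_ac mult_1_left mult_1_right)
  ultimately show ?thesis
    using case_2_0[of C r s] case_2_1[of C r s] case_2_1[of C s r] case_2_2[of C r s] T_eq Q dist
    by (elim insertE emptyE) (simp_all only: prod.insert prod.empty finite.intros insert_iff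
       empty_iff mult_1_right simp_thms)
qed

text \<open>Now \<open>p\<close> is a triple zero and the other zeros form any subset of
  \<open>{r, s, t}\<close>; a subset of size \<open>j\<close> gives degree \<open>3 + j\<close>. The
  empty and the full subset lead to the same relations.\<close>

lemma regular_case:
  assumes Qp: "poly Q p = 0" and T_eq: "T = [:-r, 1:] * [:-s, 1:] * [:-t, 1:]"
    and dist: "r \<noteq> s" "r \<noteq> t" "s \<noteq> t" and Tp: "poly T p \<noteq> 0"
  shows "degree Q \<in> {3, 6} \<and> (r - p) + (s - p) + (t - p) = 0 \<and>
      (r - p) * (s - p) + (r - p) * (t - p) + (s - p) * (t - p) = 0 \<or>
    degree Q = 4 \<and> (heun_quartic p r s t \<or> heun_quartic p s r t \<or> heun_quartic p t r s) \<or>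
    degree Q = 5 \<and> (heun_quintic p r s t \<or> heun_quintic p s r t \<or> heun_quintic p t r s)"
proof -
  have "order p T = 0"
    using Tp by (rule order_0I)
  moreover obtain C A where A: "A \<subseteq> {z. poly T z = 0}"
      and "Q = smult C ([:-p, 1:] ^ (3 - order p T) * (\<Prod>z\<in>A. [:-z, 1:]))"
    using decomposition[OF Qp] by blast
  ultimately have Q: "Q = smult C ([:-p, 1:] ^ 3 * (\<Prod>z\<in>A. [:-z, 1:]))"
    by simp
  have "poly T z = 0 \<longleftrightarrow> z \<in> {r, s, t}" for z
    unfolding T_eq poly_mult by auto
  with A have "A \<in> Pow {r, s, t}"
    by auto
  hence "A \<in> {{}, {r}, {s}, {t}, {r, s}, {r, t}, {s, t}, {r, s, t}}"
    by (simp add: Pow_insert) blast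
  moreover have
    "T = 1 * ([:-r, 1:] * [:-s, 1:] * [:-t, 1:])" "T = ([:-r, 1:] * [:-s, 1:] * [:-t, 1:]) * 1"
    "T = [:-r, 1:] * ([:-s, 1:] * [:-t, 1:])" "T = [:-s, 1:] * ([:-r, 1:] * [:-t, 1:])"
    "T = [:-t, 1:] * ([:-r, 1:] * [:-s, 1:])" "T = ([:-s, 1:] * [:-t, 1:]) * [:-r, 1:]"
    "T = ([:-r, 1:] * [:-t, 1:]) * [:-s, 1:]" "T = ([:-r, 1:] * [:-s, 1:]) * [:-t, 1:]"
    by (simp_all only: T_eq mult_ac mult_1_left mult_1_right)
  ultimately show ?thesis
    using case_3_0[of C r s t] case_3_1[of C r s t] case_3_1[of C s r t] case_3_1[of C t r s]
      case_3_2[of C s t r] case_3_2[of C r t s] case_3_2[of C r s t] case_3_3[of C r s t] Q dist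
    by (elim insertE emptyE) (simp_all only: prod.insert prod.empty finite.intros insert_iff
       empty_iff mult_1_right mult.assoc simp_thms)
qed

end

section \<open>From rational to polynomial substitutions\<close>

lemma eventually_poly_nonzero:
  fixes A :: "complex poly"
  shows "A \<noteq> 0 \<Longrightarrow> \<forall>\<^sub>F t in cofinite. poly A t \<noteq> 0"
  by (simp add: eventually_cofinite poly_roots_finite)

lemma poly_eqI_cofinite:
  fixes A B :: "complex poly"
  assumes "\<forall>\<^sub>F t in cofinite. poly A t = poly B t"
  shows "A = B"
proof (rule ccontr)
  assume "A \<noteq> B"
  hence "\<forall>\<^sub>F t in cofinite. poly (A - B) t \<noteq> 0"
    by (intro eventually_poly_nonzero) simp
  with assms have "\<forall>\<^sub>F t::complex in cofinite. False"
    by eventually_elim simp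
  thus False
    by (simp add: eventually_cofinite infinite_UNIV_char_0)
qed

text \<open>At a pole of \<open>R = N / D\<close> the quotient \<open>R'\<^sup>2 / (R (R - 1))\<close> has a double pole.\<close>

lemma denominator_constant:
  fixes N D V T :: "complex poly"
  assumes "coprime N D" "N \<noteq> 0" "D \<noteq> 0" "N \<noteq> D" "V \<noteq> 0" "rsquarefree T"
    and eq: "smult k ((pderiv N * D - N * pderiv D) ^ 2 * T) = V * (N * (N - D)) * D ^ 2"
  shows "degree D = 0"
proof (rule ccontr)
  define U where "U = pderiv N * D - N * pderiv D"
  assume "degree D \<noteq> 0"
  hence dD: "pderiv D \<noteq> 0"
    by (simp add: pderiv_eq_0_iff)
  obtain x where x: "poly D x = 0"
    using alg_closed_imp_poly_has_root[of D] \<open>degree D \<noteq> 0\<close> by auto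
  hence Nx: "poly N x \<noteq> 0"
    using coprime_poly_0[OF \<open>coprime N D\<close>, of x] by simp
  define m where "m = order x (pderiv D)"
  have m: "order x D = Suc m"
    unfolding m_def by (rule order_pderiv[OF \<open>D \<noteq> 0\<close> x])
  have "V * (N * (N - D)) * D ^ 2 \<noteq> 0"
    using assms by simp
  hence nz: "k \<noteq> 0" "U \<noteq> 0" "T \<noteq> 0" "smult k (U ^ 2 * T) \<noteq> 0"
    using eq by (auto simp: U_def)
  \<comment> \<open>In \<open>U\<close> the term \<open>pderiv N * D\<close> vanishes at least to
    order \<open>m + 1\<close> at \<open>x\<close>, but \<open>N * pderiv D\<close> exactly to order
    \<open>m\<close>, as \<open>N\<close> is nonzero there.\<close>
  have "order x U \<le> m"
  proof (rule ccontr)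
    assume "\<not> ?thesis"
    hence "[:-x, 1:] ^ Suc m dvd U"
      by (simp add: order_divides del: power_Suc)
    moreover have "[:-x, 1:] ^ Suc m dvd pderiv N * D"
      using order_1[of x D] m by (intro dvd_mult) simp
    ultimately have "[:-x, 1:] ^ Suc m dvd pderiv N * D - U"
      by (rule dvd_diff[rotated])
    hence "[:-x, 1:] ^ Suc m dvd pderiv D * N"
      by (simp add: U_def mult.commute del: power_Suc)
    hence "[:-x, 1:] ^ Suc m dvd pderiv D"
      by (rule linear_power_dvd_mult_cancel) (rule Nx)
    thus False
      using dD by (simp add: order_divides m_def del: power_Suc)
  qed
  moreover have "order x T \<le> 1"
    using \<open>rsquarefree T\<close> by (auto simp: rsquarefree_def dest!: spec[of _ x])
  moreover have "order x (smult k (U ^ 2 * T)) = 2 * order x U + order x T"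
    using nz by (simp add: order_smult order_mult power2_eq_square)
  \<comment> \<open>\<open>D ^ 2\<close> has order \<open>2 * m + 2\<close>, whereas
    \<open>U ^ 2 * T\<close> has order at most \<open>2 * m + 1\<close>.\<close>
  moreover have "2 * Suc m \<le> order x (smult k (U ^ 2 * T))"
  proof -
    have "D ^ 2 dvd smult k (U ^ 2 * T)"
      unfolding U_def eq by (rule dvd_triv_right)
    hence "order x (D ^ 2) \<le> order x (smult k (U ^ 2 * T))"
      by (rule dvd_imp_order_le[OF nz(4)])
    thus ?thesis
      using m \<open>D \<noteq> 0\<close> by (simp add: power2_eq_square order_mult)
  qed
  ultimately show False
    by simp
qed

lemma deriv_poly: "deriv (poly P) = poly (pderiv P)" for P :: "complex poly"
  by (rule ext) (rule DERIV_imp_deriv[OF poly_DERIV])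

lemma rsquarefree_heun:
  fixes d :: complex
  assumes "d \<noteq> 0" "d \<noteq> 1"
  shows "rsquarefree ([:0, 1:] * [:-1, 1:] * [:-d, 1:])"
  unfolding rsquarefree_roots
proof (intro allI notI, elim conjE)
  fix z
  assume "poly ([:0, 1:] * [:-1, 1:] * [:-d, 1:]) z = 0"
  hence "z = 0 \<or> z = 1 \<or> z = d"
    unfolding poly_mult by auto
  moreover assume "poly (pderiv ([:0, 1:] * [:-1, 1:] * [:-d, 1:])) z = 0"
  \<comment> \<open>The derivative has the values \<open>d\<close>, \<open>1 - d\<close> and
    \<open>d * (d - 1)\<close> at \<open>0\<close>, \<open>1\<close> and \<open>d\<close>; the last
    is rewritten to make its nonvanishing visible.\<close>
  moreover have factor: "d + d * (d - 2) = d * (d - 1)"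
    by (simp add: algebra_simps)
  ultimately show False
    unfolding pderiv_mult using assms factor by (auto simp: pderiv_pCons)
qed

text \<open>Pointwise form of the comparison: \<open>x / y\<close> stands for the value of
  \<open>R = N / D\<close>, and \<open>u / y^2\<close> for that of its derivative.\<close>

lemma clear_denominators:
  fixes u x y k v w :: complex
  assumes "(u / y^2)^2 * (k / (x / y * (x / y - 1))) = v / w"
    and "x \<noteq> 0" "y \<noteq> 0" "x - y \<noteq> 0" "w \<noteq> 0"
  shows "k * (u^2 * w) = v * (x * (x - y)) * y^2"
proof -
  have "x / y - 1 = (x - y) / y"
    using assms by (simp add: field_simps)
  hence "(u / y^2)^2 * (k / (x / y * (x / y - 1))) = k * u^2 / (y^2 * (x * (x - y)))"
    using assms(2-5) by (simp add: power2_eq_square mult_ac)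
  with assms show ?thesis
    by (simp add: frac_eq_eq mult_ac)
qed

lemma rational_reduction_polynomial:
  assumes R: "rational_function R" "\<not> R constant_on UNIV" and d: "d \<noteq> 0" "d \<noteq> 1"
    and V: "\<alpha> * \<beta> \<noteq> 0 \<or> q \<noteq> 0"
    and eq: "same_ode (pullback_ode R (hypergeometric_ode a b c)) (heun_ode d q \<alpha> \<beta> \<gamma> \<delta> \<epsilon>)"
  obtains P where "R = poly P" "degree P > 0"
proof -
  obtain N D where ND: "D \<noteq> 0" "coprime N D" and R_eq: "R = (\<lambda>t. poly N t / poly D t)"
    using R(1) unfolding rational_function_def by blast
  define T where "T = [:0, 1:] * [:-1, 1:] * [:-d, 1:]"
  define U where "U = pderiv N * D - N * pderiv D"
  have "N \<noteq> 0"
    using R(2) by (auto simp: R_eq constant_on_def)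
  have "degree D = 0"
  \<comment> \<open>If \<open>N = D\<close>, then \<open>R - 1\<close> cannot be a denominator, but
    coprimality already makes \<open>D\<close> a unit.\<close>
  proof (cases "N = D")
    case True
    thus ?thesis
      using ND by (simp add: is_unit_iff_degree)
  next
    case False
    hence "N - D \<noteq> 0"
      by simp
    have "T \<noteq> 0"
      by (simp add: T_def)
    have "\<forall>\<^sub>F t in cofinite. poly (smult (a * b) (U ^ 2 * T)) t =
        poly ([:-q, \<alpha> * \<beta>:] * (N * (N - D)) * D ^ 2) t"
      using eventually_poly_nonzero[OF \<open>D \<noteq> 0\<close>] eventually_poly_nonzero[OF \<open>N \<noteq> 0\<close>]
        eventually_poly_nonzero[OF \<open>N - D \<noteq> 0\<close>] eventually_poly_nonzero[OF \<open>T \<noteq> 0\<close>]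
        eq[unfolded same_ode_def]
    proof eventually_elim
      case (elim t)
      have "(R has_field_derivative poly U t / (poly D t)^2) (at t)"
        unfolding R_eq U_def using elim(1)
        by (auto intro!: derivative_eq_intros simp: power2_eq_square)
      hence "deriv R t = poly U t / (poly D t)^2"
        by (rule DERIV_imp_deriv)
      moreover have "poly T t = t * (t - 1) * (t - d)"
        by (simp add: T_def algebra_simps)
      ultimately have "(poly U t / (poly D t)^2)^2 *
          (a * b / (poly N t / poly D t * (poly N t / poly D t - 1))) =
          (\<alpha> * \<beta> * t - q) / poly T t"
        using elim by (simp add: pullback_ode_def hypergeometric_ode_def heun_ode_def R_eq)
      hence "a * b * ((poly U t)^2 * poly T t) =
          (\<alpha> * \<beta> * t - q) * (poly N t * (poly N t - poly D t)) * (poly D t)^2"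
        by (rule clear_denominators) (use elim in simp_all)
      thus ?case
        by (simp add: algebra_simps)
    qed
    hence "smult (a * b) (U ^ 2 * T) = [:-q, \<alpha> * \<beta>:] * (N * (N - D)) * D ^ 2"
      by (rule poly_eqI_cofinite)
    moreover have "rsquarefree T"
      unfolding T_def by (rule rsquarefree_heun[OF d])
    moreover have "[:-q, \<alpha> * \<beta>:] \<noteq> 0"
      using V by auto
    ultimately show ?thesis
      using denominator_constant[of N D "[:-q, \<alpha> * \<beta>:]" T "a * b"] ND \<open>N \<noteq> 0\<close> False
      unfolding U_def by blast
  qed
  then obtain e where "D = [:e:]"
    by (rule degree_eq_zeroE)
  hence R_poly: "R = poly (smult (1 / e) N)"
    by (auto simp: R_eq)
  moreover have "degree (smult (1 / e) N) > 0"
  proof (rule ccontr)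
    assume "\<not> ?thesis"
    hence "degree (smult (1 / e) N) = 0"
      by simp
    then obtain h where "smult (1 / e) N = [:h:]"
      by (rule degree_eq_zeroE)
    with R(2) R_poly show False
      by (auto simp: constant_on_def)
  qed
  ultimately show thesis
    by (rule that)
qed

section \<open>Polynomial substitutions and the locale assumptions\<close>

lemma degree_diff_1:
  fixes P :: "complex poly"
  assumes "degree P > 0"
  shows "degree (P - 1) = degree P" and "degree (1 - P) = degree P"
proof -
  show *: "degree (P - 1) = degree P"
    using degree_add_eq_left[of "-1" P] assms by simp
  thus "degree (1 - P) = degree P"
    using degree_minus[of "P - 1"] by simp
qed

text \<open>\<open>Q * (Q - 1)\<close> is invariant under replacing \<open>Q\<close> by
  \<open>1 - Q\<close>, while \<open>pderiv Q\<close> and the bracket in \<open>F\<close> both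
  change sign.\<close>

lemma (in polynomial_reduction) swap: "polynomial_reduction (1 - Q) T G p e c"
proof
  have deg: "degree (1 - Q) = degree Q"
    by (rule degree_diff_1(2)[OF degree_pos])
  have dQ: "pderiv (1 - Q) = - pderiv Q"
    by (simp add: pderiv_diff)
  show "rsquarefree T" "poly T p = 0 \<Longrightarrow> poly G p \<noteq> 0" "0 < degree (1 - Q)"
    using T G degree_pos deg by auto
  have "[:-p, 1:] * (1 - Q) * (1 - Q - 1) = [:-p, 1:] * Q * (Q - 1)"
    by algebra
  thus "smult (of_nat (degree (1 - Q)) ^ 2) ([:-p, 1:] * (1 - Q) * (1 - Q - 1)) =
      T * pderiv (1 - Q) ^ 2"
    using E by (simp only: deg dQ power2_minus)
  have "smult (2*e - 1) (1 - Q - 1) + smult (2*c - 1) (1 - Q) =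
      - (smult (2*c - 1) (Q - 1) + smult (2*e - 1) Q)"
    by (simp add: algebra_simps smult_diff_right smult_diff_left)
  thus "T * pderiv (1 - Q) * [:-p, 1:] * (smult (2*e - 1) (1 - Q - 1) + smult (2*c - 1) (1 - Q)) =
      (1 - Q) * (1 - Q - 1) * (2 * [:-p, 1:] * G + T - [:-p, 1:] * pderiv T)"
    using F unfolding dQ by (simp only:) algebra
qed

lemma polynomial_reduction_heun:
  fixes P :: "complex poly" and d q \<alpha> \<beta> \<gamma> \<delta> \<epsilon> a b c :: complex
  defines "T \<equiv> [:0, 1:] * [:-1, 1:] * [:-d, 1:]"
  defines "G \<equiv> smult \<gamma> ([:-1, 1:] * [:-d, 1:]) + smult \<delta> ([:0, 1:] * [:-d, 1:]) +
    smult \<epsilon> ([:0, 1:] * [:-1, 1:])"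
  assumes deg: "degree P > 0" and d: "d \<noteq> 0" "d \<noteq> 1"
    and four: "four_singular_points d q \<alpha> \<beta> \<gamma> \<delta> \<epsilon>"
    and V: "\<alpha> * \<beta> \<noteq> 0 \<or> q \<noteq> 0"
    and eq: "same_ode (pullback_ode (poly P) (hypergeometric_ode a b c))
      (heun_ode d q \<alpha> \<beta> \<gamma> \<delta> \<epsilon>)"
  shows "\<alpha> * \<beta> \<noteq> 0"
    and "polynomial_reduction P T G (q / (\<alpha> * \<beta>)) c (a + b - c + 1)"
proof -
  define V where "V = [:-q, \<alpha> * \<beta>:]"
  define e where "e = a + b - c + 1"
  have nz: "P \<noteq> 0" "P - 1 \<noteq> 0" "pderiv P \<noteq> 0" "T \<noteq> 0" "V \<noteq> 0"
    using deg V by (auto simp: pderiv_eq_0_iff T_def V_def)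
  have degT: "degree T = 3" and lcT: "lead_coeff T = 1"
    by (simp_all add: T_def)
  note ev = eventually_poly_nonzero[OF nz(1)] eventually_poly_nonzero[OF nz(2)]
    eventually_poly_nonzero[OF nz(3)] eventually_poly_nonzero[OF nz(4)] eq[unfolded same_ode_def]
  have "\<forall>\<^sub>F t in cofinite. poly (smult (a * b) (pderiv P ^ 2 * T)) t = poly (V * (P * (P - 1))) t"
    using ev
  proof eventually_elim
    case (elim t)
    moreover have "poly T t = t * (t - 1) * (t - d)"
      by (simp add: T_def algebra_simps)
    \<comment> \<open>The denominators \<open>1\<close> match \<open>clear_denominators\<close> with
      \<open>y = 1\<close>.\<close>
    ultimately have "(poly (pderiv P) t / 1^2)^2 *
        (a * b / (poly P t / 1 * (poly P t / 1 - 1))) = poly V t / poly T t"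
      by (simp add: pullback_ode_def hypergeometric_ode_def heun_ode_def deriv_poly V_def mult_ac)
    hence "a * b * ((poly (pderiv P) t)^2 * poly T t) =
        poly V t * (poly P t * (poly P t - 1)) * 1^2"
      by (rule clear_denominators) (use elim in simp_all)
    thus ?case
      by (simp add: algebra_simps)
  qed
  hence eqV: "smult (a * b) (pderiv P ^ 2 * T) = V * (P * (P - 1))"
    by (rule poly_eqI_cofinite)
  define n where "n = degree P"
  have degP: "degree (P - 1) = degree P"
    by (rule degree_diff_1(1)[OF deg])
  have lcP: "lead_coeff (P - 1) = lead_coeff P"
    using deg by (simp add: degP coeff_eq_0)
  have "V * (P * (P - 1)) \<noteq> 0"
    using nz by simp
  hence ab: "a * b \<noteq> 0"
    using eqV by auto
  \<comment> \<open>Degrees give \<open>2 * (n - 1) + 3 = degree V + 2 * n\<close>, so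
    \<open>V\<close> is linear.\<close>
  have "degree (smult (a * b) (pderiv P ^ 2 * T)) = 2 * (n - 1) + 3"
    using ab nz by (simp add: degree_mult_eq degree_power_eq degree_pderiv degT n_def)
  moreover have "degree (V * (P * (P - 1))) = degree V + 2 * n"
    using nz by (simp add: degree_mult_eq degP n_def)
  ultimately have "degree V = 1"
    using eqV deg n_def by simp
  thus nz': "\<alpha> * \<beta> \<noteq> 0"
    by (auto simp: V_def split: if_splits)
  define p where "p = q / (\<alpha> * \<beta>)"
  have V_eq: "V = smult (\<alpha> * \<beta>) [:-p, 1:]"
    using nz' by (simp add: V_def p_def)
  \<comment> \<open>Leading coefficients determine \<open>\<alpha> * \<beta>\<close> as
    \<open>a * b * n^2\<close>; dividing by \<open>a * b\<close> then gives
    \<open>E\<close>.\<close>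
  have "lead_coeff (pderiv P) = of_nat n * lead_coeff P"
    using deg by (simp add: degree_pderiv coeff_pderiv n_def)
  hence "lead_coeff (smult (a * b) (pderiv P ^ 2 * T)) = a * b * (of_nat n * lead_coeff P) ^ 2"
    by (simp only: lead_coeff_smult lead_coeff_mult lead_coeff_power lcT mult_1_right)
  moreover have "lead_coeff (V * (P * (P - 1))) = \<alpha> * \<beta> * (lead_coeff P) ^ 2"
    by (simp only: lead_coeff_mult lcP V_eq lead_coeff_smult) (simp add: power2_eq_square)
  ultimately have ab_eq: "\<alpha> * \<beta> = a * b * of_nat n ^ 2"
    using eqV nz by (simp add: power_mult_distrib)
  have "smult (a * b) (smult (of_nat n ^ 2) ([:-p, 1:] * P * (P - 1))) = V * (P * (P - 1))"
    by (simp only: V_eq ab_eq smult_smult mult_smult_left mult.assoc)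
  also have "\<dots> = smult (a * b) (T * pderiv P ^ 2)"
    by (simp only: mult.commute[of T] flip: eqV)
  finally have "smult (a * b) (smult (of_nat n ^ 2) ([:-p, 1:] * P * (P - 1))) =
      smult (a * b) (T * pderiv P ^ 2)" .
  hence E: "smult (of_nat n ^ 2) ([:-p, 1:] * P * (P - 1)) = T * pderiv P ^ 2"
    using ab by (metis smult_cancel)
  define X where "X = [:-p, 1:]"
  define K where "K = [:of_nat n ^ 2 :: complex:]"
  have dX: "pderiv X = 1" and dK: "pderiv K = 0"
    by (simp_all add: X_def K_def pderiv_pCons)
  have E': "K * (X * P * (P - 1)) = T * pderiv P ^ 2"
    using E by (simp add: X_def K_def)
  hence "pderiv (K * (X * P * (P - 1))) = pderiv (T * pderiv P ^ 2)"
    by (rule arg_cong)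
  hence dE: "K * (P * (P - 1) + X * pderiv P * (2 * P - 1)) =
      pderiv T * pderiv P ^ 2 + 2 * T * pderiv P * pderiv (pderiv P)"
    unfolding power2_eq_square pderiv_mult pderiv_diff pderiv_1 dX dK by algebra
  \<comment> \<open>The coefficients of \<open>u'\<close> are compared after multiplication by
    \<open>T * pderiv P * P * (P - 1)\<close>.\<close>
  have "\<forall>\<^sub>F t in cofinite.
      poly (T * (pderiv P ^ 2 * ([:c:] * (P - 1) + [:e:] * P) - pderiv (pderiv P) * P * (P - 1))) t =
      poly (G * pderiv P * P * (P - 1)) t"
    using ev
  proof eventually_elim
    case (elim t)
    have "poly G t / poly T t = \<gamma> / t + \<delta> / (t - 1) + \<epsilon> / (t - d)"
    proof -
      have Tt: "poly T t = t * (t - 1) * (t - d)"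
        by (simp add: T_def algebra_simps)
      have Gt: "poly G t = \<gamma> * ((t - 1) * (t - d)) + \<delta> * (t * (t - d)) + \<epsilon> * (t * (t - 1))"
        by (simp add: G_def algebra_simps)
      have "t \<noteq> 0" "t - 1 \<noteq> 0" "t - d \<noteq> 0"
        using elim Tt by auto
      thus ?thesis
        unfolding Tt Gt add_divide_distrib by simp
    qed
    with elim have "poly (pderiv P) t * (c / poly P t + e / (poly P t - 1)) -
        poly (pderiv (pderiv P)) t / poly (pderiv P) t = poly G t / poly T t"
      by (simp add: pullback_ode_def hypergeometric_ode_def heun_ode_def deriv_poly e_def)
    with elim(1-4) show ?case
      by (simp add: divide_simps) algebra
  qed
  hence first: "T * (pderiv P ^ 2 * ([:c:] * (P - 1) + [:e:] * P) -
      pderiv (pderiv P) * P * (P - 1)) = G * pderiv P * P * (P - 1)"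
    by (rule poly_eqI_cofinite)
  \<comment> \<open>Multiply \<open>first\<close> by \<open>2 * X * pderiv P\<close>, eliminate the
    second derivative by \<open>dE\<close>, and replace \<open>K * X * P * (P - 1)\<close> by
    \<open>E'\<close>. The factor \<open>2 * P - 1 = (P - 1) + P\<close> from \<open>dE\<close>
    turns \<open>2 * c\<close> and \<open>2 * e\<close> into \<open>2 * c - 1\<close> and
    \<open>2 * e - 1\<close>.\<close>
  have "pderiv P ^ 2 * (T * pderiv P * X * ((2 * [:c:] - 1) * (P - 1) + (2 * [:e:] - 1) * P)) =
      pderiv P ^ 2 * (P * (P - 1) * (2 * X * G + T - X * pderiv T))"
    using first E' dE by algebra
  hence F: "T * pderiv P * X * ((2 * [:c:] - 1) * (P - 1) + (2 * [:e:] - 1) * P) =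
      P * (P - 1) * (2 * X * G + T - X * pderiv T)"
    by (rule mult_left_cancel[THEN iffD1, rotated]) (use nz in simp)
  have smult_eq: "smult (2 * x - 1) A = (2 * [:x:] - 1) * A" for x and A :: "complex poly"
  proof -
    have "2 * [:x:] - 1 = [:2 * x - 1:]"
      by (simp add: one_pCons numeral_poly)
    thus ?thesis
      by (simp only:) simp
  qed
  have "polynomial_reduction P T G p c e"
  proof
    show "rsquarefree T"
      unfolding T_def by (rule rsquarefree_heun[OF d])
    show "0 < degree P"
      by (rule deg)
    show "poly G p \<noteq> 0" if "poly T p = 0"
    proof -
      \<comment> \<open>If \<open>p\<close> is one of \<open>0\<close>, \<open>1\<close>,
        \<open>d\<close>, the numerator \<open>\<alpha> * \<beta> * t - q\<close> vanishes there, so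
        a genuine singularity needs a nonzero residue \<open>\<gamma>\<close>,
        \<open>\<delta>\<close> or \<open>\<epsilon>\<close>; \<open>G\<close> at \<open>p\<close>
        is a nonzero multiple of it.\<close>
      have "q = \<alpha> * \<beta> * p"
        using nz' by (simp add: p_def)
      with four have "p = 0 \<Longrightarrow> \<gamma> \<noteq> 0" "p = 1 \<Longrightarrow> \<delta> \<noteq> 0" "p = d \<Longrightarrow> \<epsilon> \<noteq> 0"
        by (auto simp: four_singular_points_def)
      moreover have "p \<in> {0, 1, d}"
        using that unfolding T_def poly_mult by auto
      ultimately show ?thesis
        using d unfolding G_def poly_add poly_smult poly_mult by auto
    qed
    show "smult (of_nat (degree P) ^ 2) ([:-p, 1:] * P * (P - 1)) = T * pderiv P ^ 2"
      using E by (simp add: n_def)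
    show "T * pderiv P * [:-p, 1:] * (smult (2 * c - 1) (P - 1) + smult (2 * e - 1) P) =
        P * (P - 1) * (2 * [:-p, 1:] * G + T - [:-p, 1:] * pderiv T)"
      using F by (simp only: X_def smult_eq)
  qed
  thus "polynomial_reduction P T G (q / (\<alpha> * \<beta>)) c (a + b - c + 1)"
    by (simp only: p_def e_def)
qed

section \<open>The exceptional parameters\<close>

text \<open>Completing the square gives the roots \<open>m + \<i> * k\<close> and
  \<open>m - \<i> * k\<close>. As \<open>d\<close> is a real affine function of \<open>p\<close>,
  one sign \<open>s\<close> serves both.\<close>

lemma heun_pair:
  fixes p d :: complex and u v w m k a b :: real
  assumes eq: "of_real u * p^2 + of_real v * p + of_real w = 0" and u: "u \<noteq> 0"
    and v: "v = - (2 * u * m)" and w: "w = u * (m^2 + k^2)"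
    and d: "d = of_real a * p + of_real b"
  shows "\<exists>s\<in>{1, -1}. (d, p) = (Complex (a * m + b) (s * (a * k)), Complex m (s * k))"
proof -
  have "of_real u * ((p - of_real m)^2 - (\<i> * of_real k)^2) = 0"
    using eq unfolding v w by (simp add: algebra_simps power2_eq_square)
  hence "(p - of_real m)^2 = (\<i> * of_real k)^2"
    using u by simp
  hence "p = of_real m + \<i> * of_real k \<or> p = of_real m - \<i> * of_real k"
    unfolding power2_eq_iff by (auto simp: algebra_simps)
  thus ?thesis
    using d by (auto simp: complex_eq_iff)
qed

text \<open>The differences are the three cube roots of one number, so \<open>0\<close>,
  \<open>1\<close>, \<open>d\<close> form an equilateral triangle with centre
  \<open>p\<close>.\<close>

lemma heun_pair_2a:
  assumes "(0 - p) + (1 - p) + (d - p) = 0"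
    and "(0 - p) * (1 - p) + (0 - p) * (d - p) + (1 - p) * (d - p) = 0"
  shows "\<exists>s\<in>{1, -1}.
    (d, p) = (Complex (1/2) (s * sqrt 3 / 2),
      Complex (1/2) (s * sqrt 3 / 6))"
proof -
  have d: "d = 3 * p - 1"
    using assms by algebra
  have quad: "3 * p^2 - 3 * p + 1 = 0"
    using assms d by algebra
  have "d = of_real 3 * p + of_real (-1)"
    using d by (simp add: field_simps)
  with quad have "\<exists>s\<in>{1, -1}. (d, p) =
      (Complex (3 * (1/2) + (-1)) (s * (3 * (sqrt 3 / 6))), Complex (1/2) (s * (sqrt 3 / 6)))"
    by (intro heun_pair[of 3 p "-3" 1]) (simp_all add: power_divide power_mult_distrib)
  thus ?thesis
    by (simp add: mult.commute)
qed

text \<open>The linear relation expresses \<open>d\<close> by \<open>p\<close>, and the other one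
  becomes a quadratic equation for \<open>p\<close>. The suffix names the simple zero of
  \<open>Q\<close>.\<close>

lemma heun_pair_2b_d:
  assumes "heun_quartic p d 0 1"
  shows "\<exists>s\<in>{1, -1}.
    (d, p) = (Complex (1/2) (s * 5 * sqrt 2 / 4),
      Complex (1/2) (s * sqrt 2 / 4))"
proof -
  have d: "d = 5 * p - 2"
    using assms unfolding heun_quartic_def by algebra
  have quad: "8 * p^2 - 8 * p + 3 = 0"
    using assms d unfolding heun_quartic_def by algebra
  have "d = of_real 5 * p + of_real (-2)"
    using d by (simp add: field_simps)
  with quad have "\<exists>s\<in>{1, -1}. (d, p) =
      (Complex (5 * (1/2) + (-2)) (s * (5 * (sqrt 2 / 4))), Complex (1/2) (s * (sqrt 2 / 4)))"
    by (intro heun_pair[of 8 p "-8" 3]) (simp_all add: power_divide power_mult_distrib)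
  thus ?thesis
    by (simp add: mult.commute)
qed

lemma heun_pair_2b_1:
  assumes "heun_quartic p 1 0 d"
  shows "\<exists>s\<in>{1, -1}.
    (d, p) = (Complex (4/27) (s * 10 * sqrt 2 / 27),
      Complex (7/27) (s * 4 * sqrt 2 / 27))"
proof -
  have d: "2 * d = 5 * p - 1"
    using assms unfolding heun_quartic_def by algebra
  have quad: "27 * p^2 - 14 * p + 3 = 0"
    using assms d unfolding heun_quartic_def by algebra
  have "d = of_real (5/2) * p + of_real (-1/2)"
    using d by (simp add: field_simps)
  with quad have "\<exists>s\<in>{1, -1}. (d, p) =
      (Complex (5/2 * (7/27) + (-1/2)) (s * (5/2 * (4 * sqrt 2 / 27))), Complex (7/27) (s * (4 * sqrt 2 / 27)))"
    by (intro heun_pair[of 27 p "-14" 3]) (simp_all add: power_divide power_mult_distrib)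
  thus ?thesis
    by (simp add: mult.commute)
qed

lemma heun_pair_2b_0:
  assumes "heun_quartic p 0 1 d"
  shows "\<exists>s\<in>{1, -1}.
    (d, p) = (Complex (23/27) (s * 10 * sqrt 2 / 27),
      Complex (20/27) (s * 4 * sqrt 2 / 27))"
proof -
  have d: "2 * d = 5 * p - 2"
    using assms unfolding heun_quartic_def by algebra
  have quad: "27 * p^2 - 40 * p + 16 = 0"
    using assms d unfolding heun_quartic_def by algebra
  have "d = of_real (5/2) * p + of_real (-1)"
    using d by (simp add: field_simps)
  with quad have "\<exists>s\<in>{1, -1}. (d, p) =
      (Complex (5/2 * (20/27) + (-1)) (s * (5/2 * (4 * sqrt 2 / 27))), Complex (20/27) (s * (4 * sqrt 2 / 27)))"
    by (intro heun_pair[of 27 p "-40" 16]) (simp_all add: power_divide power_mult_distrib)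
  thus ?thesis
    by (simp add: mult.commute)
qed

text \<open>The same elimination; the suffix now names the singular point that is not a zero of
  \<open>Q\<close>.\<close>

lemma heun_pair_2c_d:
  assumes "heun_quintic p d 0 1"
  shows "\<exists>s\<in>{1, -1}.
    (d, p) = (Complex (1/2) (s * 11 * sqrt 15 / 90),
      Complex (1/2) (s * sqrt 15 / 18))"
proof -
  have d: "5 * d = 11 * p - 3"
    using assms unfolding heun_quintic_def by algebra
  have quad: "27 * p^2 - 27 * p + 8 = 0"
    using assms d unfolding heun_quintic_def by algebra
  have "d = of_real (11/5) * p + of_real (-3/5)"
    using d by (simp add: field_simps)
  with quad have "\<exists>s\<in>{1, -1}. (d, p) =
      (Complex (11/5 * (1/2) + (-3/5)) (s * (11/5 * (sqrt 15 / 18))), Complex (1/2) (s * (sqrt 15 / 18)))"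
    by (intro heun_pair[of 27 p "-27" 8]) (simp_all add: power_divide power_mult_distrib)
  thus ?thesis
    by (simp add: mult.commute)
qed

lemma heun_pair_2c_1:
  assumes "heun_quintic p 1 0 d"
  shows "\<exists>s\<in>{1, -1}.
    (d, p) = (Complex (135/128) (s * 33 * sqrt 15 / 128),
      Complex (95/128) (s * 9 * sqrt 15 / 128))"
proof -
  have d: "3 * d = 11 * p - 5"
    using assms unfolding heun_quintic_def by algebra
  have quad: "64 * p^2 - 95 * p + 40 = 0"
    using assms d unfolding heun_quintic_def by algebra
  have "d = of_real (11/3) * p + of_real (-5/3)"
    using d by (simp add: field_simps)
  with quad have "\<exists>s\<in>{1, -1}. (d, p) =
      (Complex (11/3 * (95/128) + (-5/3)) (s * (11/3 * (9 * sqrt 15 / 128))), Complex (95/128) (s * (9 * sqrt 15 / 128)))"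
    by (intro heun_pair[of 64 p "-95" 40]) (simp_all add: power_divide power_mult_distrib)
  thus ?thesis
    by (simp add: mult.commute)
qed

lemma heun_pair_2c_0:
  assumes "heun_quintic p 0 1 d"
  shows "\<exists>s\<in>{1, -1}.
    (d, p) = (Complex (-7/128) (s * 33 * sqrt 15 / 128),
      Complex (33/128) (s * 9 * sqrt 15 / 128))"
proof -
  have d: "3 * d = 11 * p - 3"
    using assms unfolding heun_quintic_def by algebra
  have quad: "64 * p^2 - 33 * p + 9 = 0"
    using assms d unfolding heun_quintic_def by algebra
  have "d = of_real (11/3) * p + of_real (-1)"
    using d by (simp add: field_simps)
  with quad have "\<exists>s\<in>{1, -1}. (d, p) =
      (Complex (11/3 * (33/128) + (-1)) (s * (11/3 * (9 * sqrt 15 / 128))), Complex (33/128) (s * (9 * sqrt 15 / 128)))"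
    by (intro heun_pair[of 64 p "-33" 9]) (simp_all add: power_divide power_mult_distrib)
  thus ?thesis
    by (simp add: mult.commute)
qed

lemma heun_pairs_2b:
  assumes "heun_quartic p 0 1 d \<or> heun_quartic p 1 0 d \<or> heun_quartic p d 0 1"
  shows "\<exists>s\<in>{1, -1}. (d, p) \<in>
    {(Complex (1/2) (s * 5 * sqrt 2 / 4), Complex (1/2) (s * sqrt 2 / 4)),
     (Complex (4/27) (s * 10 * sqrt 2 / 27), Complex (7/27) (s * 4 * sqrt 2 / 27)),
     (Complex (23/27) (s * 10 * sqrt 2 / 27), Complex (20/27) (s * 4 * sqrt 2 / 27))}"
  using assms
proof (elim disjE)
  assume "heun_quartic p 0 1 d"
  from heun_pair_2b_0[OF this] show ?thesis
    by (rule bexE) (rule bexI[rotated], assumption, simp only: insert_iff simp_thms)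
next
  assume "heun_quartic p 1 0 d"
  from heun_pair_2b_1[OF this] show ?thesis
    by (rule bexE) (rule bexI[rotated], assumption, simp only: insert_iff simp_thms)
next
  assume "heun_quartic p d 0 1"
  from heun_pair_2b_d[OF this] show ?thesis
    by (rule bexE) (rule bexI[rotated], assumption, simp only: insert_iff simp_thms)
qed

lemma heun_pairs_2c:
  assumes "heun_quintic p 0 1 d \<or> heun_quintic p 1 0 d \<or> heun_quintic p d 0 1"
  shows "\<exists>s\<in>{1, -1}. (d, p) \<in>
    {(Complex (1/2) (s * 11 * sqrt 15 / 90), Complex (1/2) (s * sqrt 15 / 18)),
     (Complex (135/128) (s * 33 * sqrt 15 / 128), Complex (95/128) (s * 9 * sqrt 15 / 128)),
     (Complex (-7/128) (s * 33 * sqrt 15 / 128), Complex (33/128) (s * 9 * sqrt 15 / 128))}"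
  using assms
proof (elim disjE)
  assume "heun_quintic p 0 1 d"
  from heun_pair_2c_0[OF this] show ?thesis
    by (rule bexE) (rule bexI[rotated], assumption, simp only: insert_iff simp_thms)
next
  assume "heun_quintic p 1 0 d"
  from heun_pair_2c_1[OF this] show ?thesis
    by (rule bexE) (rule bexI[rotated], assumption, simp only: insert_iff simp_thms)
next
  assume "heun_quintic p d 0 1"
  from heun_pair_2c_d[OF this] show ?thesis
    by (rule bexE) (rule bexI[rotated], assumption, simp only: insert_iff simp_thms)
qed

theorem theorem3p7:
  fixes d q \<alpha> \<beta> \<gamma> \<delta> \<epsilon> :: complex and R :: "complex \<Rightarrow> complex"
  assumes "d \<noteq> 0" and "d \<noteq> 1"
    and "\<alpha> + \<beta> - \<gamma> - \<delta> - \<epsilon> + 1 = 0"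
    and "\<gamma> \<notin> \<int>\<^sub>\<le>\<^sub>0"
    and "four_singular_points d q \<alpha> \<beta> \<gamma> \<delta> \<epsilon>"
    and "\<alpha> * \<beta> \<noteq> 0 \<or> q \<noteq> 0"
    and "reduces_Hl_to_2F1 d q \<alpha> \<beta> \<gamma> \<delta> R"
  shows "\<exists>p. q = \<alpha> * \<beta> * p \<and>
    (\<exists>P :: complex poly. R = poly P \<and>
      ((d, p) \<in> {(-1, 0), (1/2, 1/2), (2, 1)}
         \<and> degree P \<in> {2, 4} \<or>
       (d, p) \<in> {(-3, 0), (-1/3, 0), (1/4, 1/4), (3/4, 3/4), (4/3, 1), (4, 1)}
         \<and> degree P = 3 \<or>
       (\<exists>s \<in> {1, -1 :: real}.
          (d, p) = (Complex (1/2) (s * sqrt 3 / 2), Complex (1/2) (s * sqrt 3 / 6))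
            \<and> degree P \<in> {3, 6} \<or>
          (d, p) \<in> {(Complex (1/2) (s * 5 * sqrt 2 / 4), Complex (1/2) (s * sqrt 2 / 4)),
                    (Complex (4/27) (s * 10 * sqrt 2 / 27), Complex (7/27) (s * 4 * sqrt 2 / 27)),
                    (Complex (23/27) (s * 10 * sqrt 2 / 27), Complex (20/27) (s * 4 * sqrt 2 / 27))}
            \<and> degree P = 4 \<or>
          (d, p) \<in> {(Complex (1/2) (s * 11 * sqrt 15 / 90), Complex (1/2) (s * sqrt 15 / 18)),
                    (Complex (135/128) (s * 33 * sqrt 15 / 128), Complex (95/128) (s * 9 * sqrt 15 / 128)),
                    (Complex (-7/128) (s * 33 * sqrt 15 / 128), Complex (33/128) (s * 9 * sqrt 15 / 128))}
            \<and> degree P = 5)))"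
proof -
  obtain a b c where R: "rational_function R" "\<not> R constant_on UNIV"
      and "same_ode (pullback_ode R (hypergeometric_ode a b c))
        (heun_ode d q \<alpha> \<beta> \<gamma> \<delta> (\<alpha> + \<beta> - \<gamma> - \<delta> + 1))"
    using assms(7) unfolding reduces_Hl_to_2F1_def by blast
  moreover have "\<alpha> + \<beta> - \<gamma> - \<delta> + 1 = \<epsilon>"
    using assms(3) by algebra
  ultimately have eq: "same_ode (pullback_ode R (hypergeometric_ode a b c))
      (heun_ode d q \<alpha> \<beta> \<gamma> \<delta> \<epsilon>)"
    by simp
  obtain P where P: "R = poly P" "degree P > 0"
    using rational_reduction_polynomial[OF R assms(1,2,6) eq] .
  define p where "p = q / (\<alpha> * \<beta>)"
  define T where "T = [:0, 1:] * [:-1, 1:] * [:-d, 1:]"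
  note reduction = polynomial_reduction_heun[OF P(2) assms(1,2,5,6) eq[unfolded P(1)],
      folded p_def T_def]
  have q: "q = \<alpha> * \<beta> * p"
    using reduction(1) by (simp add: p_def)
  \<comment> \<open>\<open>Q\<close> is \<open>P\<close> or \<open>1 - P\<close>, whichever vanishes
    at \<open>p\<close>; the degree is unaffected.\<close>
  obtain Q G c' e' where Q: "polynomial_reduction Q T G p c' e'" "poly Q p = 0" "degree Q = degree P"
  proof (cases "poly P p = 0")
    case True
    thus ?thesis
      using that[OF reduction(2)] by simp
  next
    case False
    hence "poly (1 - P) p = 0"
      using polynomial_reduction.value_at_p[OF reduction(2)] by simp
    moreover have "degree (1 - P) = degree P"
      by (rule degree_diff_1(2)[OF P(2)])
    ultimately show ?thesis
      using that[OF polynomial_reduction.swap[OF reduction(2)]] by simp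
  qed
  interpret polynomial_reduction Q T G p c' e'
    by (rule Q(1))
  show ?thesis
  proof (intro exI[of _ p] exI[of _ P] conjI q P(1), fold Q(3))
    show "(d, p) \<in> {(-1, 0), (1/2, 1/2), (2, 1)}
         \<and> degree Q \<in> {2, 4} \<or>
       (d, p) \<in> {(-3, 0), (-1/3, 0), (1/4, 1/4), (3/4, 3/4), (4/3, 1), (4, 1)}
         \<and> degree Q = 3 \<or>
       (\<exists>s \<in> {1, -1 :: real}.
          (d, p) = (Complex (1/2) (s * sqrt 3 / 2), Complex (1/2) (s * sqrt 3 / 6))
            \<and> degree Q \<in> {3, 6} \<or>
          (d, p) \<in> {(Complex (1/2) (s * 5 * sqrt 2 / 4), Complex (1/2) (s * sqrt 2 / 4)),
                    (Complex (4/27) (s * 10 * sqrt 2 / 27), Complex (7/27) (s * 4 * sqrt 2 / 27)),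
                    (Complex (23/27) (s * 10 * sqrt 2 / 27), Complex (20/27) (s * 4 * sqrt 2 / 27))}
            \<and> degree Q = 4 \<or>
          (d, p) \<in> {(Complex (1/2) (s * 11 * sqrt 15 / 90), Complex (1/2) (s * sqrt 15 / 18)),
                    (Complex (135/128) (s * 33 * sqrt 15 / 128), Complex (95/128) (s * 9 * sqrt 15 / 128)),
                    (Complex (-7/128) (s * 33 * sqrt 15 / 128), Complex (33/128) (s * 9 * sqrt 15 / 128))}
            \<and> degree Q = 5)"
      (is "?A \<or> ?B \<or> (\<exists>s\<in>{1, -1}. ?C s \<or> ?D s \<or> ?E s)")
    proof (cases "poly T p = 0")
      case True
      hence "p = 0 \<or> p = 1 \<or> p = d"
        unfolding T_def poly_mult by auto
      \<comment> \<open>With \<open>p\<close> fixed at \<open>0\<close>, \<open>1\<close> or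
        \<open>d\<close>, each relation of \<open>singular_case\<close> is linear in
        \<open>d\<close>: one value for degree 2 or 4, and two for degree 3.\<close>
      hence "?A \<or> ?B"
      proof (elim disjE)
        assume p: "p = 0"
        have "T = [:-p, 1:] * ([:-1, 1:] * [:-d, 1:])"
          unfolding T_def p mult.assoc by simp
        from singular_case[OF Q(2) this] p assms(1,2) show ?thesis
          by (auto simp: field_simps eq_neg_iff_add_eq_0 add.commute)
      next
        assume p: "p = 1"
        have "T = [:-p, 1:] * ([:-0, 1:] * [:-d, 1:])"
          unfolding T_def p by (simp only: mult_ac minus_zero)
        from singular_case[OF Q(2) this] p assms(1,2) show ?thesis
          by (auto simp: field_simps eq_neg_iff_add_eq_0 add.commute)
      next
        assume p: "p = d"
        have "T = [:-p, 1:] * ([:-0, 1:] * [:-1, 1:])"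
          unfolding T_def p by (simp only: mult_ac minus_zero)
        from singular_case[OF Q(2) this] p assms(1,2) show ?thesis
          by (auto simp: field_simps eq_neg_iff_add_eq_0 add.commute)
      qed
      thus ?thesis
        by blast
    next
      case False
      \<comment> \<open>Writing \<open>-0\<close> lets the first factor match
        \<open>[:-r, 1:]\<close> with \<open>r = 0\<close>.\<close>
      have T_eq: "T = [:-0, 1:] * [:-1, 1:] * [:-d, 1:]"
        by (simp only: T_def minus_zero)
      note cases = regular_case[OF Q(2) T_eq zero_neq_one assms(1)[symmetric] assms(2)[symmetric]
          False]
      consider (cubic) "degree Q \<in> {3, 6}" "(0 - p) + (1 - p) + (d - p) = 0"
          "(0 - p) * (1 - p) + (0 - p) * (d - p) + (1 - p) * (d - p) = 0"
        | (quartic) "degree Q = 4"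
          "heun_quartic p 0 1 d \<or> heun_quartic p 1 0 d \<or> heun_quartic p d 0 1"
        | (quintic) "degree Q = 5"
          "heun_quintic p 0 1 d \<or> heun_quintic p 1 0 d \<or> heun_quintic p d 0 1"
        using cases by blast
      hence "\<exists>s\<in>{1, -1}. ?C s \<or> ?D s \<or> ?E s"
      proof cases
        case cubic
        with heun_pair_2a[OF cubic(2,3)] obtain s where "s \<in> {1, -1}" "?C s"
          by (elim bexE) (rule that, assumption, rule conjI)
        thus ?thesis
          by (intro bexI[of _ s] disjI1)
      next
        case quartic
        with heun_pairs_2b[OF quartic(2)] obtain s where "s \<in> {1, -1}" "?D s"
          by (elim bexE) (rule that, assumption, rule conjI)
        thus ?thesis
          by (intro bexI[of _ s]) (rule disjI2, rule disjI1)
      next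
        case quintic
        with heun_pairs_2c[OF quintic(2)] obtain s where "s \<in> {1, -1}" "?E s"
          by (elim bexE) (rule that, assumption, rule conjI)
        thus ?thesis
          by (intro bexI[of _ s] disjI2)
      qed
      thus ?thesis
        by (intro disjI2)
    qed
  qed
qed

end
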